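(* Consider the network described in the context with the on-off power allocation strategy, in the asymptotic regime $K\to\infty$. If $M=\Theta(K)$ and $0<\alpha<1$, then, for large $K$, the maximum network average sum-rate $\bar R_{ave}$ is less than the maximum network average sum-rate for $M=1$. Consequently, the maximum average sum-rate of the network over all values $1\le M\le K$ is achieved at $M=1$.
   Context: Network: $K$ transmitter-receiver links are partitioned into $M$ clusters $\mathbb{C}_j=\{(j-1)n+1,\dots,jn\}$, $j=1,\dots,M$, with $n=K/M$ an integer; here $M$ may scale with $K$. Cluster $j$ uses its own orthogonal subchannel of bandwidth $W/M$ (there is no interference between clusters); $W,N_0>0$ are fixed constants. Channel gains: the gain from transmitter $k$ to receiver $i$ is $\mathcal{L}_{ki}$. For $k=i$, $\mathcal{L}_{ii}=h_{ii}$ is exponential with mean 1. For $k\ne i$, $\mathcal{L}_{ki}=\beta_{ki}h_{ki}$ with probability $\alpha$ and $\mathcal{L}_{ki}=0$ with probability $1-\alpha$, where $\alpha\in[0,1]$ is fixed, $h_{ki}$ is exponential with mean 1, and $\beta_{ki}$ is independent of $h_{ki}$, identically distributed over $(k,i)$, with $0<\beta_{\min}\le\beta_{ki}\le\beta_{\max}<\infty$ and $\mathbb{E}[\beta_{ki}]=\varpi\le 1$. All gains are mutually independent for different $(k,i)$. Powers and rates: in the on-off power allocation strategy every user $i$ uses power $p_i=1$ if $h_{ii}>\tau_n$ and $p_i=0$ otherwise, with a common threshold $\tau_n$ (depending on $n$). For $i\in\mathbb{C}_j$ the interference is $I_i=\sum_{k\in\mathbb{C}_j,k\ne i}\mathcal{L}_{ki}p_k$,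 and the rate is $R_i=\frac{W}{M}\log\left(1+\frac{h_{ii}p_i}{I_i+N_0W/M}\right)$ ($\log$ natural). The network average sum-rate is $\bar R_{ave}=\mathbb{E}\left[\sum_{j=1}^M\sum_{l\in\mathbb{C}_j}R_l\right]$; its maximum for given $M$ is over the choice of threshold. $M=\Theta(K)$ means that $M/K$ tends to a constant in $(0,\infty)$. *)

theory Defs
  imports "HOL-Probability.Probability"
begin

text \<open>Gain from transmitter \<open>k\<close> to receiver \<open>i\<close>: \<open>\<xi> k i\<close> is the random event that the cross
  link from \<open>k\<close> to \<open>i\<close> is present, \<open>\<beta> k i\<close> is its shadowing and \<open>h k i\<close> its fading.\<close>

definition gain ::
  "(nat \<Rightarrow> nat \<Rightarrow> 'a \<Rightarrow> real) \<Rightarrow> (nat \<Rightarrow> nat \<Rightarrow> 'a \<Rightarrow> real) \<Rightarrow> (nat \<Rightarrow> nat \<Rightarrow> 'a \<Rightarrow> bool)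
    \<Rightarrow> nat \<Rightarrow> nat \<Rightarrow> 'a \<Rightarrow> real" where
  "gain h \<beta> \<xi> k i \<omega> =
    (if k = i then h i i \<omega> else if \<xi> k i \<omega> then \<beta> k i \<omega> * h k i \<omega> else 0)"

text \<open>The gains form one infinite array, of which the network with \<open>K\<close> links uses the
  entries with indices in \<open>{1..K}\<close>. Only the joint law of these entries enters the average
  rates, so nothing depends on the coupling of networks of different sizes.

  The values of \<open>\<beta>\<close> and \<open>\<xi>\<close> on the diagonal are never used and are unconstrained.
  For each cross link, \<open>\<xi>\<close>, \<open>\<beta>\<close> and \<open>h\<close> are mutually independent, so the gain is \<open>\<beta> h\<close> with
  probability \<open>\<alpha>\<close> and \<open>0\<close> otherwise. Across different pairs only the gains are assumed
  independent.\<close>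

locale random_network = prob_space P
  for P :: "'a measure" +
  fixes \<alpha> \<beta>min \<beta>max \<mu> :: real
    and h \<beta> :: "nat \<Rightarrow> nat \<Rightarrow> 'a \<Rightarrow> real"
    and \<xi> :: "nat \<Rightarrow> nat \<Rightarrow> 'a \<Rightarrow> bool"
  assumes alpha_range: "0 \<le> \<alpha>" "\<alpha> \<le> 1"
    and beta_min_pos: "0 < \<beta>min"
    and mean_le_1: "\<mu> \<le> 1"
    and h_exponential: "\<And>k i. distributed P lborel (h k i) (exponential_density 1)"
    and link_measurable: "\<And>k i. k \<noteq> i \<Longrightarrow> random_variable (count_space UNIV) (\<xi> k i)"
    and link_prob: "\<And>k i. k \<noteq> i \<Longrightarrow> prob {\<omega> \<in> space P. \<xi> k i \<omega>} = \<alpha>"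
    and beta_measurable: "\<And>k i. k \<noteq> i \<Longrightarrow> random_variable borel (\<beta> k i)"
    and beta_bounded: "\<And>k i. k \<noteq> i \<Longrightarrow> AE \<omega> in P. \<beta>min \<le> \<beta> k i \<omega> \<and> \<beta> k i \<omega> \<le> \<beta>max"
    and beta_identically_distributed:
      "\<And>k i k' i'. k \<noteq> i \<Longrightarrow> k' \<noteq> i' \<Longrightarrow> distr P borel (\<beta> k i) = distr P borel (\<beta> k' i')"
    and beta_mean: "\<And>k i. k \<noteq> i \<Longrightarrow> expectation (\<beta> k i) = \<mu>"
    and gains_independent:
      "indep_vars (\<lambda>_. borel) (\<lambda>(k, i). gain h \<beta> \<xi> k i) UNIV"
    and within_link_independent:
      "\<And>k i. k \<noteq> i \<Longrightarrow>
        indep_vars (\<lambda>_. borel) (\<lambda>m. [\<lambda>\<omega>. of_bool (\<xi> k i \<omega>), \<beta> k i, h k i] ! m) {..<3}"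

definition cluster :: "nat \<Rightarrow> nat \<Rightarrow> nat \<Rightarrow> nat set" where
  "cluster K M j = {(j - 1) * (K div M) + 1 .. j * (K div M)}"

definition on_off_power :: "('i \<Rightarrow> 'i \<Rightarrow> 'a \<Rightarrow> real) \<Rightarrow> real \<Rightarrow> 'i \<Rightarrow> 'a \<Rightarrow> real" where
  "on_off_power L \<tau> i \<omega> = (if L i i \<omega> > \<tau> then 1 else 0)"

definition interference ::
  "('i \<Rightarrow> 'i \<Rightarrow> 'a \<Rightarrow> real) \<Rightarrow> real \<Rightarrow> 'i set \<Rightarrow> 'i \<Rightarrow> 'a \<Rightarrow> real" where
  "interference L \<tau> C i \<omega> = (\<Sum>k\<in>C - {i}. L k i \<omega> * on_off_power L \<tau> k \<omega>)"

definition rate ::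
  "('i \<Rightarrow> 'i \<Rightarrow> 'a \<Rightarrow> real) \<Rightarrow> real \<Rightarrow> real \<Rightarrow> nat \<Rightarrow> real \<Rightarrow> 'i set \<Rightarrow> 'i \<Rightarrow> 'a \<Rightarrow> real" where
  "rate L W N0 M \<tau> C i \<omega> =
    W / real M * ln (1 + L i i \<omega> * on_off_power L \<tau> i \<omega> /
      (interference L \<tau> C i \<omega> + N0 * W / real M))"

definition average_sum_rate ::
  "'a measure \<Rightarrow> (nat \<Rightarrow> nat \<Rightarrow> 'a \<Rightarrow> real) \<Rightarrow> real \<Rightarrow> real \<Rightarrow> nat \<Rightarrow> nat \<Rightarrow> real \<Rightarrow> real" where
  "average_sum_rate P L W N0 K M \<tau> =
    (\<integral>\<omega>. (\<Sum>j=1..M. \<Sum>l\<in>cluster K M j. rate L W N0 M \<tau> (cluster K M j) l \<omega>) \<partial>P)"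

text \<open>The supremum is over all thresholds. It is finite: dropping the interference bounds every
  rate by \<open>h l l / N0\<close> (almost surely), so the average sum-rate is at most \<open>K / N0\<close>.\<close>

definition max_average_sum_rate ::
  "'a measure \<Rightarrow> (nat \<Rightarrow> nat \<Rightarrow> 'a \<Rightarrow> real) \<Rightarrow> real \<Rightarrow> real \<Rightarrow> nat \<Rightarrow> nat \<Rightarrow> real" where
  "max_average_sum_rate P L W N0 K M = (SUP \<tau>. average_sum_rate P L W N0 K M \<tau>)"

end

theory Submission
  imports Defs "HOL-Real_Asymp.Real_Asymp"
begin

text \<open>Write \<open>n = K / M\<close>, \<open>q = exp (- \<tau>)\<close>, \<open>\<lambda> = n q\<close> for the expected number of active users
  in a cluster, \<open>d = \<alpha> \<mu>\<close> and \<open>b = N0 W\<close>. Dividing by \<open>W\<close>, the average sum-rate is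
  \<open>\<lambda> E ln (1 + H / (I + b / M))\<close>, where \<open>H - \<tau>\<close> is exponential (\<open>H\<close> being conditioned on \<open>H > \<tau>\<close>) and \<open>I\<close> has mean
  about \<open>\<lambda> d\<close>. For \<open>M = 1\<close> and \<open>\<lambda> = (ln K)\<^sup>2\<close>, Jensen's inequality yields \<open>(1 / d) ln K\<close> to
  leading order. Every other \<open>M\<close> and \<open>\<tau>\<close> falls into one of three cases.

  \<^item> If \<open>\<lambda>\<close> is bounded, the only term of order \<open>ln K\<close> is the chance of (almost) no interference
    times \<open>ln M\<close>, with a coefficient at most \<open>max 1 (8 / (9 \<alpha>)) < 1 / \<alpha> \<le> 1 / d\<close> up to an
    arbitrarily small factor.
  \<^item> If \<open>\<lambda>\<close> is large but either at most \<open>C (\<tau> + 1)\<close> or at most \<open>ln M\<close>, then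
    \<open>I\<close> concentrates and the rate is at most \<open>\<kappa> ln K\<close> with \<open>\<kappa> < 1 / d\<close>.
  \<^item> Otherwise the threshold \<open>\<tau> + ln M\<close> for \<open>M = 1\<close> has the same \<open>\<lambda>\<close> and nearly the same mean
    interference, but the signals of the active users are larger by \<open>ln M\<close>. This gains a
    positive multiple of \<open>ln M\<close>, which exceeds all error terms.\<close>

subsection \<open>Elementary inequalities\<close>

lemma ln_ge_one_minus_inverse: "1 - 1 / x \<le> ln x" if "0 < x" for x :: real
  using ln_le_minus_one[of "1 / x"] that by (simp add: ln_div)

text \<open>A single logarithm of a quotient, to which \<open>ln z \<le> z - 1\<close> from above or
  \<open>1 - 1 / z \<le> ln z\<close> from below can then be applied.\<close>

lemma ln_one_plus_div_diff:
  fixes h g x y :: real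
  assumes "0 \<le> h" "0 \<le> g" "0 < x" "0 < y"
  shows "ln (1 + h / x) - ln (1 + g / y) = ln ((x + h) * y / (x * (y + g)))"
proof -
  have "1 + h / x = (x + h) / x" "1 + g / y = (y + g) / y"
    using assms by (auto simp: field_simps)
  then show ?thesis
    using assms by (simp add: ln_divide_pos ln_mult_pos add_pos_nonneg)
qed

text \<open>Concavity in \<open>h\<close>, with the tangent taken at \<open>a\<close>. For
  \<open>a = \<tau> + 1\<close>, the mean of the signal given that it exceeds \<open>\<tau>\<close>,
  the linear term averages to zero, so the bound acts as Jensen's inequality.\<close>

lemma ln_one_plus_div_tangent:
  fixes h a m :: real
  assumes "0 \<le> h" "0 \<le> a" "0 < m"
  shows "ln (1 + h / m) \<le> ln (1 + a / m) + (h - a) / (m + a)"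
proof -
  have "ln (1 + h / m) - ln (1 + a / m) = ln ((m + h) / (m + a))"
    using assms by (simp add: ln_one_plus_div_diff)
  also have "\<dots> \<le> (m + h) / (m + a) - 1"
    using assms by (intro ln_le_minus_one) auto
  also have "\<dots> = (h - a) / (m + a)"
    using assms by (simp add: field_simps)
  finally show ?thesis by simp
qed

text \<open>Expansion in the interference \<open>x\<close> around its mean \<open>m\<close>. The
  first-order term is centred, and \<open>\<theta>\<close> keeps \<open>x\<close> away from zero, so
  that the variance controls the remainder.\<close>

lemma ln_one_plus_div_le_second_order:
  fixes h m x :: real
  assumes "0 \<le> h" "0 < m" "0 < \<theta>" "\<theta> * m \<le> x"
  shows "ln (1 + h / x)
    \<le> ln (1 + h / m) + h / (m + h) * ((m - x) / m) + h / m * ((m - x)\<^sup>2 / (\<theta> * m\<^sup>2))"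
proof -
  have x: "0 < x"
    using assms by (meson less_le_trans mult_pos_pos)
  have "ln (1 + h / x) - ln (1 + h / m) = ln ((x + h) * m / (x * (m + h)))"
    using assms x by (intro ln_one_plus_div_diff) auto
  also have "\<dots> \<le> (x + h) * m / (x * (m + h)) - 1"
    using assms x by (intro ln_le_minus_one) auto
  also have "\<dots> = h / (m + h) * ((m - x) / x)"
    using assms x by (simp add: divide_simps add_pos_nonneg) (simp add: algebra_simps)
  also have "(m - x) / x = (m - x) / m + (m - x)\<^sup>2 / (x * m)"
    using assms x by (simp add: field_simps power2_eq_square)
  also have "h / (m + h) * ((m - x) / m + (m - x)\<^sup>2 / (x * m))
      = h / (m + h) * ((m - x) / m) + h / (m + h) * ((m - x)\<^sup>2 / (x * m))"
    by (rule distrib_left)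
  also have "h / (m + h) * ((m - x)\<^sup>2 / (x * m)) \<le> h / m * ((m - x)\<^sup>2 / (\<theta> * m\<^sup>2))"
  proof (rule mult_mono)
    show "h / (m + h) \<le> h / m"
      using assms by (intro divide_left_mono) auto
    have "\<theta> * m\<^sup>2 \<le> x * m"
      using assms by (simp add: power2_eq_square)
    then show "(m - x)\<^sup>2 / (x * m) \<le> (m - x)\<^sup>2 / (\<theta> * m\<^sup>2)"
      using assms x by (intro divide_left_mono) auto
  qed (use assms x in auto)
  finally show ?thesis by simp
qed

text \<open>From \<open>\<theta> * m\<close> on the second-order expansion applies; below it only
  the noise \<open>s\<close> is kept in the denominator. Every summand is a function of
  \<open>h\<close> times a function of \<open>x\<close>, so independence can be used term by
  term.\<close>

lemma ln_one_plus_div_le_concentrated: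
  fixes h a m s x :: real
  assumes "0 \<le> h" "0 \<le> a" "0 < m" "0 < \<theta>" "\<theta> \<le> 1" "0 < s" "0 \<le> x"
  shows "ln (1 + h / (x + s))
    \<le> ln (1 + a / m) + (h - a) / (m + a)
      + h / (m + h) * ((m - x) / m) + h * ((m - x)\<^sup>2 / (\<theta> * m ^ 3))
      + of_bool (x < \<theta> * m) * (ln (1 + a / s) + (h - a) / (s + a))"
proof -
  have 1: "ln (1 + h / m) \<le> ln (1 + a / m) + (h - a) / (m + a)"
    using assms by (intro ln_one_plus_div_tangent) auto
  have sq: "h * ((m - x)\<^sup>2 / (\<theta> * m ^ 3)) = h / m * ((m - x)\<^sup>2 / (\<theta> * m\<^sup>2))"
    by (simp add: power2_eq_square power3_eq_cube)
  show ?thesis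
  proof (cases "x < \<theta> * m")
    case True
    \<comment> \<open>Here the interference is below its mean, so both correction terms are
      nonnegative and the indicator term alone dominates the left side.\<close>
    have "\<theta> * m \<le> 1 * m"
      using assms by (intro mult_right_mono) auto
    then have "x \<le> m"
      using True by simp
    then have "0 \<le> h / (m + h) * ((m - x) / m)" "0 \<le> h * ((m - x)\<^sup>2 / (\<theta> * m ^ 3))"
      using assms True by (auto intro!: mult_nonneg_nonneg divide_nonneg_nonneg)
    moreover have "0 \<le> ln (1 + h / m)"
      using assms by simp
    moreover have "ln (1 + h / (x + s)) \<le> ln (1 + h / s)"
      using assms by (subst ln_le_cancel_iff) (auto intro!: divide_left_mono add_pos_nonneg)
    moreover have "ln (1 + h / s) \<le> ln (1 + a / s) + (h - a) / (s + a)"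
      using assms by (intro ln_one_plus_div_tangent) auto
    ultimately show ?thesis
      using 1 True by simp
  next
    case False
    have x: "0 < x"
      using assms False by (meson less_le_trans mult_pos_pos not_le)
    have "ln (1 + h / (x + s)) \<le> ln (1 + h / x)"
      using assms x by (subst ln_le_cancel_iff) (auto intro!: divide_left_mono add_pos_nonneg)
    moreover have "ln (1 + h / x) \<le> ln (1 + h / m) + h / (m + h) * ((m - x) / m)
        + h / m * ((m - x)\<^sup>2 / (\<theta> * m\<^sup>2))"
      using assms False by (intro ln_one_plus_div_le_second_order) auto
    ultimately show ?thesis
      using 1 False unfolding sq by simp
  qed
qed

text \<open>A coarser bound for interference that need not concentrate: if it is below
  \<open>\<eta>\<close> it is dropped, otherwise it is replaced by \<open>\<eta>\<close> and the
  noise is dropped.\<close>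

lemma ln_one_plus_div_le_split:
  fixes h a s x \<eta> :: real
  assumes "0 \<le> h" "0 \<le> a" "0 < \<eta>" "0 < s" "0 \<le> x"
  shows "ln (1 + h / (x + s)) \<le> of_bool (x < \<eta>) * (ln (1 + a / s) + (h - a) / (s + a))
      + (ln (1 + a / \<eta>) + (h - a) / (\<eta> + a))"
proof -
  have t: "ln (1 + h / s) \<le> ln (1 + a / s) + (h - a) / (s + a)"
    "ln (1 + h / \<eta>) \<le> ln (1 + a / \<eta>) + (h - a) / (\<eta> + a)"
    using assms by (auto intro!: ln_one_plus_div_tangent)
  have n: "0 \<le> ln (1 + h / \<eta>)"
    using assms by simp
  have "ln (1 + h / (x + s)) \<le> ln (1 + h / s)"
    using assms by (subst ln_le_cancel_iff) (auto intro!: divide_left_mono add_pos_nonneg)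
  moreover have "ln (1 + h / (x + s)) \<le> ln (1 + h / \<eta>)" if "\<not> x < \<eta>"
    using assms that by (subst ln_le_cancel_iff) (auto intro!: divide_left_mono add_pos_nonneg)
  ultimately show ?thesis
    using t n by (cases "x < \<eta>") auto
qed

text \<open>\<open>B\<close> stands for a bound on noise plus mean interference. With
  \<open>u\<close> the deviation of \<open>h\<close> from \<open>a\<close> relative to
  \<open>B + a\<close>, the proof rests on \<open>u - 2 * u^2 \<le> ln (1 + u)\<close>, valid for
  \<open>u \<ge> - 1 / 2\<close>; the hypotheses \<open>a - 1 \<le> h\<close> and
  \<open>2 \<le> B + a\<close> ensure this range.\<close>

lemma ln_one_plus_div_ge:
  fixes a B h b x :: real
  assumes "1 \<le> a" "2 \<le> B + a" "a - 1 \<le> h" "0 < h" "0 < b" "0 < B" "0 \<le> x"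
  shows "ln (1 + a / B) + (h - a) / (B + a) - 2 / (B + a)\<^sup>2 * (h - a)\<^sup>2
      + h / (B + h) * ((B - b - x) / B) \<le> ln (1 + h / (x + b))"
proof -
  define u where "u = (h - a) / (B + a)"
  have "1 \<le> (B + a) / 2"
    using assms by simp
  moreover have "- 1 \<le> h - a"
    using assms(3) by linarith
  ultimately have "- (1 / 2) * (B + a) \<le> h - a"
    by linarith
  then have u: "- (1/2) \<le> u"
    unfolding u_def using assms by (subst pos_le_divide_eq) auto
  have "u - 2 * u\<^sup>2 \<le> 1 - 1 / (1 + u)"
  proof -
    have "1 - 1 / (1 + u) - (u - 2 * u\<^sup>2) = u\<^sup>2 * (1 + 2 * u) / (1 + u)"
      using u by (simp add: field_simps power2_eq_square)
    also have "\<dots> \<ge> 0"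
      using u by (intro divide_nonneg_nonneg mult_nonneg_nonneg) auto
    finally show ?thesis by simp
  qed
  also have "\<dots> \<le> ln (1 + u)"
    using u by (intro ln_ge_one_minus_inverse) auto
  also have "ln (1 + u) = ln (1 + h / B) - ln (1 + a / B)"
  proof -
    have "1 + u = (B + h) * B / (B * (B + a))"
      using assms by (simp add: u_def divide_simps)
    then show ?thesis
      using assms by (simp add: ln_one_plus_div_diff)
  qed
  finally have 1: "ln (1 + a / B) + u - 2 * u\<^sup>2 \<le> ln (1 + h / B)" by simp
  define y where "y = x + b"
  have y: "0 < y" "0 < h"
    using assms by (auto simp: y_def)
  \<comment> \<open>Passing from \<open>h / (B + h)\<close> to \<open>h / (y + h)\<close> changes
    this factor by an amount with the sign of \<open>B - y\<close>, so the inequality holds on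
    either side of \<open>B\<close>. The left side is affine in \<open>y\<close>, which allows
    taking expectations.\<close>
  have "h / (B + h) * ((B - y) / B) \<le> h / (y + h) * ((B - y) / B)"
  proof (cases "y \<le> B")
    case True
    then show ?thesis
      using assms y by (intro mult_right_mono divide_left_mono) auto
  next
    case False
    then show ?thesis
      using assms y by (intro mult_right_mono_neg divide_left_mono) (auto simp: divide_nonpos_pos)
  qed
  also have "\<dots> = 1 - 1 / (B * (y + h) / (y * (B + h)))"
    using assms y by (simp add: divide_simps; simp add: algebra_simps)
  also have "\<dots> \<le> ln (B * (y + h) / (y * (B + h)))"
    using assms y by (intro ln_ge_one_minus_inverse) auto
  also have "\<dots> = ln (1 + h / y) - ln (1 + h / B)"
    using assms y by (subst ln_one_plus_div_diff) (auto simp: mult.commute)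
  finally have "h / (B + h) * ((B - y) / B) \<le> ln (1 + h / y) - ln (1 + h / B)" .
  with 1 show ?thesis
    by (simp add: u_def y_def power_divide algebra_simps)
qed

text \<open>With \<open>u = a / b\<close> this separates \<open>ln M\<close>, the benefit of the low
  noise level \<open>b / M\<close> in a narrow subchannel.\<close>

lemma ln_one_plus_mult_le:
  fixes u M :: real
  assumes "0 \<le> u" "1 \<le> M"
  shows "ln (1 + u * M) \<le> ln M + ln (1 + u)"
proof -
  have "1 + u * M \<le> M * (1 + u)"
    using assms by (simp add: algebra_simps)
  then have "ln (1 + u * M) \<le> ln (M * (1 + u))"
    using assms by (subst ln_le_cancel_iff) (auto intro!: mult_pos_pos add_pos_nonneg)
  then show ?thesis
    using assms by (simp add: ln_mult_pos)
qed

text \<open>The quotient \<open>ln (1 + x) / x\<close> decreases, so its value at \<open>x0\<close>,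
  strictly below 1, serves for all larger \<open>x\<close>. The proof follows the tangent at
  \<open>x0\<close>, whose slope \<open>1 / (1 + x0)\<close> is at most that value.\<close>

lemma ln_one_plus_le_slope:
  fixes x0 :: real
  assumes "0 < x0"
  obtains \<rho> where "0 < \<rho>" "\<rho> < 1" "\<And>x. x0 \<le> x \<Longrightarrow> ln (1 + x) \<le> (1 - \<rho>) * x"
proof
  define r where "r = ln (1 + x0) / x0"
  have "x0 / (1 + x0) \<le> ln (1 + x0)"
    using ln_ge_one_minus_inverse[of "1 + x0"] assms by (simp add: field_simps)
  then have r: "1 / (1 + x0) \<le> r"
    using assms by (simp add: r_def field_simps)
  have "ln (1 + x0) < x0"
    using assms by (rule ln_add_one_self_less_self)
  then show "0 < 1 - r" "1 - r < 1"
    using assms by (auto simp: r_def)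
  show "ln (1 + x) \<le> (1 - (1 - r)) * x" if "x0 \<le> x" for x
  proof -
    have "ln (1 + x) \<le> ln (1 + x0) + (x - x0) * (1 / (1 + x0))"
      using ln_one_plus_div_tangent[of x x0 1] assms that by simp
    also have "\<dots> \<le> r * x0 + (x - x0) * r"
      using r assms that by (intro add_mono mult_left_mono) (auto simp: r_def)
    finally show ?thesis by (simp add: algebra_simps)
  qed
qed

text \<open>\<open>l\<close> is the expected number of active users in a cluster and
  \<open>p\<close> the expected number of active interferers of one receiver. Exponential decay in
  \<open>p\<close> beats powers of \<open>l\<close>, so the noise term costs at most
  \<open>\<epsilon> * ln M\<close> plus a multiple of \<open>a / l\<close>, uniformly in
  \<open>p\<close>, \<open>a\<close> and \<open>M\<close>.\<close>

lemma concentrated_bound_simplified: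
  fixes d b c \<gamma> \<epsilon> :: real
  assumes "0 < d" "0 < b" "0 < \<gamma>" "0 \<le> c" "0 < \<epsilon>"
  shows "\<forall>\<^sub>F l in at_top. \<forall>p a M. l - 1 \<le> p \<longrightarrow> 0 \<le> a \<longrightarrow> 1 \<le> M \<longrightarrow>
    l * (ln (1 + a / (p * d)) + c * a / (p * d)\<^sup>2 + exp (- \<gamma> * p) * ln (1 + a / (b / M)))
    \<le> l * ln (1 + a / (p * d)) + (4 * c / d\<^sup>2 + 1 / b) * a / l + \<epsilon> * ln M"
proof -
  \<comment> \<open>One factor \<open>l\<close> is the prefactor in the claim, the other produces
    the \<open>1 / l\<close> in front of \<open>a\<close>. The limit is used below
    \<open>min 1 \<epsilon>\<close>: as 1 for the term with \<open>a / b\<close>, as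
    \<open>\<epsilon>\<close> for the term with \<open>ln M\<close>.\<close>
  have "((\<lambda>l::real. l\<^sup>2 * exp (- \<gamma> * (l - 1))) \<longlongrightarrow> 0) at_top"
    using assms by real_asymp
  then have "\<forall>\<^sub>F l in at_top. l\<^sup>2 * exp (- \<gamma> * (l - 1)) < min 1 \<epsilon>"
    using assms by (intro order_tendstoD) auto
  then show ?thesis
    using eventually_ge_at_top[of "2 :: real"]
  proof eventually_elim
    case (elim l)
    show ?case
    proof (intro allI impI)
      fix p a M :: real
      assume p: "l - 1 \<le> p" and a: "0 \<le> a" and M: "1 \<le> M"
      have "c * a / (p * d)\<^sup>2 \<le> c * a / (l / 2 * d)\<^sup>2"
        using elim p a assms by (intro divide_left_mono power_mono mult_right_mono) auto
      also have "\<dots> = 4 * c / d\<^sup>2 * a / l / l"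
        by (simp add: power2_eq_square mult_ac)
      finally have "l * (c * a / (p * d)\<^sup>2) \<le> l * (4 * c / d\<^sup>2 * a / l / l)"
        using elim by (intro mult_left_mono) auto
      then have 1: "l * (c * a / (p * d)\<^sup>2) \<le> 4 * c / d\<^sup>2 * a / l"
        using elim by simp
      have e: "l * exp (- \<gamma> * p) \<le> min 1 \<epsilon> / l"
      proof -
        have "l * exp (- \<gamma> * p) \<le> l * exp (- \<gamma> * (l - 1))"
          using elim p assms by (intro mult_left_mono) auto
        also have "\<dots> \<le> min 1 \<epsilon> / l"
          using elim by (simp add: field_simps power2_eq_square)
        finally show ?thesis .
      qed
      have "ln (1 + a / (b / M)) \<le> ln M + ln (1 + a / b)"
        using ln_one_plus_mult_le[of "a / b" M] a M assms by simp
      also have "ln (1 + a / b) \<le> a / b"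
        using a assms by (intro ln_add_one_self_le_self) auto
      finally have "l * exp (- \<gamma> * p) * ln (1 + a / (b / M)) \<le> min 1 \<epsilon> / l * (ln M + a / b)"
        using e elim a M assms by (intro mult_mono) auto
      also have "\<dots> = min 1 \<epsilon> / l * ln M + min 1 \<epsilon> / l * (a / b)"
        by (rule distrib_left)
      also have "\<dots> \<le> \<epsilon> * ln M + 1 / l * (a / b)"
      proof (intro add_mono mult_right_mono)
        have "min 1 \<epsilon> / l \<le> min 1 \<epsilon> / 1"
          using elim assms by (intro divide_left_mono) auto
        then show "min 1 \<epsilon> / l \<le> \<epsilon>" by simp
      qed (use elim a M assms in \<open>auto intro!: divide_right_mono\<close>)
      finally show "l * (ln (1 + a / (p * d)) + c * a / (p * d)\<^sup>2 + exp (- \<gamma> * p) * ln (1 + a / (b / M)))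
          \<le> l * ln (1 + a / (p * d)) + (4 * c / d\<^sup>2 + 1 / b) * a / l + \<epsilon> * ln M"
        using 1 by (simp add: algebra_simps add_divide_distrib)
    qed
  qed
qed

text \<open>Uniform in \<open>\<tau>\<close>, since a large threshold makes \<open>l\<close> small.
  If \<open>l \<ge> 1\<close> then \<open>\<tau> \<le> ln n\<close>; if \<open>l < 1\<close> then
  \<open>l * ln (1 / l) \<le> 1 - l\<close> bounds \<open>l * (\<tau> + 1)\<close> by
  \<open>ln n + 1\<close>, and \<open>l\<close> can be moved inside the logarithm.\<close>

lemma rate_bound_few_active:
  fixes l l0 n \<tau> x :: real
  assumes "l = n * exp (- \<tau>)" "l \<le> l0" "1 \<le> l0" "1 \<le> n" "0 \<le> \<tau>" "0 \<le> x"
  shows "l * ln (1 + (\<tau> + 1) * x) \<le> l0 * ln (1 + (2 + ln n) * x)"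
proof -
  have l: "0 < l"
    using assms by simp
  have \<tau>: "\<tau> = ln n - ln l"
    using assms by (simp add: ln_mult_pos)
  have ln0: "0 \<le> ln n"
    using assms by simp
  show ?thesis
  proof (cases "1 \<le> l")
    case True
    then have "0 \<le> ln l"
      by simp
    then have "\<tau> + 1 \<le> 2 + ln n"
      using \<tau> by simp
    then have "ln (1 + (\<tau> + 1) * x) \<le> ln (1 + (2 + ln n) * x)"
      using assms ln0 by (subst ln_le_cancel_iff) (auto intro!: mult_right_mono add_pos_nonneg)
    then show ?thesis
      using assms l by (intro mult_mono) auto
  next
    case False
    have "l * (\<tau> + 1) = l * ln n + l * ln (1 / l) + l"
      using l by (simp add: \<tau> algebra_simps ln_div)
    also have "\<dots> \<le> 1 * ln n + l * (1 / l - 1) + l"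
      using l False ln0 by (intro add_mono mult_mono ln_le_minus_one) auto
    also have "\<dots> = ln n + 1"
      using l by (simp add: algebra_simps)
    finally have m: "l * (\<tau> + 1) \<le> 2 + ln n" by simp
    have u: "0 < 1 + (\<tau> + 1) * x"
      using assms by (auto intro!: add_pos_nonneg)
    then have "l * ln (1 + (\<tau> + 1) * x) = ln ((1 + (\<tau> + 1) * x) powr l)"
      by (simp add: ln_powr)
    \<comment> \<open>Bernoulli's inequality for an exponent below 1, read off from the weighted
      inequality of means with second number 1.\<close>
    also have "\<dots> \<le> ln (1 + l * ((\<tau> + 1) * x))"
    proof (subst ln_le_cancel_iff)
      show "(1 + (\<tau> + 1) * x) powr l \<le> 1 + l * ((\<tau> + 1) * x)"
        using Youngs_inequality_0[of l "1 - l" "1 + (\<tau> + 1) * x" 1] False l assms(5,6)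
        by (simp add: algebra_simps add_pos_nonneg)
    qed (use u assms(5,6) l in \<open>auto intro!: add_pos_nonneg\<close>)
    also have "\<dots> \<le> ln (1 + (2 + ln n) * x)"
      using m assms ln0 l mult_right_mono[OF m, of x]
      by (subst ln_le_cancel_iff) (auto intro!: add_pos_nonneg simp: mult.assoc)
    also have "\<dots> \<le> l0 * ln (1 + (2 + ln n) * x)"
      using mult_right_mono[OF assms(3), of "ln (1 + (2 + ln n) * x)"] assms(6) ln0 by simp
    finally show ?thesis .
  qed
qed

subsection \<open>Comparison of the rate bounds\<close>

text \<open>For \<open>n = 1\<close> the value is at most \<open>w\<close>. For
  \<open>n \<ge> 2\<close> one has \<open>n \<le> 2 * (n - 1)\<close>, and
  \<open>t * exp (- t) \<le> 1 / exp 1\<close> leaves a constant over \<open>\<alpha>\<close>. The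
  tolerances \<open>9 / 10\<close> and \<open>11 / 10\<close> are tight enough that
  \<open>2 * (10 / 9) * (11 / 10) * (2 / 5) = 44 / 45\<close> is below 1.\<close>

lemma few_active_coefficient:
  fixes \<alpha> q w :: real and n :: nat
  assumes "0 < \<alpha>" "\<alpha> \<le> 1" "0 \<le> q" "q \<le> 1" "1 \<le> w" "w \<le> 11 / 10" "1 \<le> n"
  shows "real n * q * (w * (1 - \<alpha> * q * (9 / 10)) ^ (n - 1)) \<le> max w (44 / (45 * \<alpha>))"
proof (cases "n = 1")
  case True
  then show ?thesis
    using mult_left_le_one_le[of w q] assms by (simp add: max.coboundedI1)
next
  case False
  define t where "t = \<alpha> * (9 / 10) * q * real (n - 1)"
  have n: "real n \<le> 2 * real (n - 1)"
    using False assms(7) by simp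
  have "\<alpha> * q \<le> 1"
    using assms by (intro mult_le_one) auto
  then have "(1 - \<alpha> * q * (9 / 10)) ^ (n - 1) \<le> exp (- (\<alpha> * q * (9 / 10))) ^ (n - 1)"
    using exp_ge_add_one_self[of "- (\<alpha> * q * (9 / 10))"] by (intro power_mono) auto
  also have "\<dots> = exp (- t)"
    unfolding exp_of_nat_mult[symmetric] t_def by (simp add: algebra_simps)
  finally have p: "(1 - \<alpha> * q * (9 / 10)) ^ (n - 1) \<le> exp (- t)" .
  have "t \<le> exp (t - 1)"
    using exp_ge_add_one_self[of "t - 1"] by simp
  then have "t * exp (- t) \<le> exp (t - 1) * exp (- t)"
    by (intro mult_right_mono) auto
  also have "\<dots> = exp (- 1)"
    by (simp add: exp_add[symmetric])
  also have "\<dots> = 1 / exp 1"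
    by (simp add: exp_minus divide_inverse)
  also have "\<dots> \<le> 1 / (5 / 2)"
    using exp_lower_Taylor_quadratic[of "1::real"] by (intro divide_left_mono) auto
  finally have t: "t * exp (- t) \<le> 2 / 5" by simp
  have "real n * q * (w * (1 - \<alpha> * q * (9 / 10)) ^ (n - 1)) \<le> 2 * real (n - 1) * q * (11 / 10 * exp (- t))"
    using n p assms \<open>\<alpha> * q \<le> 1\<close> by (intro mult_mono mult_right_mono) auto
  also have "\<dots> = 22 / (9 * \<alpha>) * (t * exp (- t))"
    using assms by (simp add: t_def)
  also have "\<dots> \<le> 22 / (9 * \<alpha>) * (2 / 5)"
    using t assms by (intro mult_left_mono) auto
  also have "\<dots> = 44 / (45 * \<alpha>)"
    by simp
  finally show ?thesis by simp
qed

text \<open>The coefficient of \<open>ln M\<close> stays below \<open>1 / \<alpha>\<close> by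
  \<open>few_active_coefficient\<close>; all other terms grow like an iterated logarithm of
  \<open>x = n * M\<close>, uniformly in how \<open>x\<close> is factored.\<close>

lemma few_active_bound:
  fixes \<alpha> g b l0 :: real
  assumes "0 < \<alpha>" "\<alpha> < 1" "0 < g" "0 < b" "1 \<le> l0"
  obtains z \<eta> c where "0 \<le> z" "0 < \<eta>" "c < 1 / \<alpha>"
    "\<forall>\<^sub>F x in at_top. \<forall>(n::nat) M \<tau>. 1 \<le> n \<longrightarrow> 1 \<le> M \<longrightarrow> x = real n * M \<longrightarrow> 0 \<le> \<tau> \<longrightarrow>
      real n * exp (- \<tau>) \<le> l0 \<longrightarrow>
      real n * (exp (- \<tau>) * (exp (z * \<eta>) * (1 - \<alpha> * exp (- \<tau>) * (z * g / (1 + z * g))) ^ (n - 1)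
        * ln (1 + (\<tau> + 1) / (b / M)) + ln (1 + (\<tau> + 1) / \<eta>))) \<le> c * ln x"
proof -
  \<comment> \<open>\<open>w\<close> is the price \<open>exp (z * \<eta>)\<close> for allowing
    interference up to \<open>\<eta>\<close>; it must exceed 1, and it is kept below both
    \<open>1 / \<alpha>\<close> and the tolerance of \<open>few_active_coefficient\<close>.\<close>
  define w where "w = min (11 / 10) ((1 + 1 / \<alpha>) / 2)"
  have w: "1 < w" "w \<le> 11 / 10" "w < 1 / \<alpha>"
    using assms by (auto simp: w_def min_less_iff_disj field_simps)
  \<comment> \<open>\<open>9 / g\<close> makes the Laplace factor \<open>z * g / (1 + z * g)\<close>
    equal to \<open>9 / 10\<close>; then \<open>\<eta>\<close> is solved from
    \<open>exp (z * \<eta>) = w\<close>.\<close>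
  define z where "z = 9 / g"
  define \<eta> where "\<eta> = ln w / z"
  have z: "0 < z" "z * g / (1 + z * g) = 9 / 10"
    using assms by (auto simp: z_def)
  have \<eta>: "0 < \<eta>" "exp (z * \<eta>) = w"
    using w z by (auto simp: \<eta>_def)
  define c0 where "c0 = max w (44 / (45 * \<alpha>))"
  have c0: "0 < c0" "c0 < 1 / \<alpha>"
    using w assms by (auto simp: c0_def field_simps)
  \<comment> \<open>The room between \<open>c0\<close> and \<open>c\<close> absorbs the terms of
    lower order than \<open>ln x\<close>.\<close>
  obtain c where c: "c0 < c" "c < 1 / \<alpha>"
    using dense[OF c0(2)] by blast
  have "((\<lambda>x. (w * (l0 * ln (1 + (2 + ln x) * (1 / b))) + l0 * ln (1 + (2 + ln x) * (1 / \<eta>))) / ln x) \<longlongrightarrow> 0) at_top"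
    using assms \<eta> by real_asymp
  then have "\<forall>\<^sub>F x in at_top. (w * (l0 * ln (1 + (2 + ln x) * (1 / b))) + l0 * ln (1 + (2 + ln x) * (1 / \<eta>))) / ln x < c - c0"
    using c by (intro order_tendstoD) auto
  then have "\<forall>\<^sub>F x in at_top. \<forall>(n::nat) M \<tau>. 1 \<le> n \<longrightarrow> 1 \<le> M \<longrightarrow> x = real n * M \<longrightarrow> 0 \<le> \<tau> \<longrightarrow>
      real n * exp (- \<tau>) \<le> l0 \<longrightarrow>
      real n * (exp (- \<tau>) * (exp (z * \<eta>) * (1 - \<alpha> * exp (- \<tau>) * (z * g / (1 + z * g))) ^ (n - 1)
        * ln (1 + (\<tau> + 1) / (b / M)) + ln (1 + (\<tau> + 1) / \<eta>))) \<le> c * ln x"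
    using eventually_gt_at_top[of "1::real"]
  proof eventually_elim
    case (elim x)
    show ?case
    proof (intro allI impI)
      fix n :: nat and M \<tau> :: real
      assume n: "1 \<le> n" and M: "1 \<le> M" and x: "x = real n * M" and \<tau>: "0 \<le> \<tau>"
        and l: "real n * exp (- \<tau>) \<le> l0"
      let ?q = "exp (- \<tau>)"
      define p where "p = (1 - \<alpha> * ?q * (9 / 10)) ^ (n - 1)"
      have "\<alpha> * ?q \<le> 1"
        using assms \<tau> by (intro mult_le_one) auto
      then have p: "0 \<le> p" "p \<le> 1"
        using assms unfolding p_def by (auto intro!: power_le_one)
      have mono: "real n * ?q * ln (1 + (\<tau> + 1) * y) \<le> l0 * ln (1 + (2 + ln x) * y)" if "0 \<le> y" for y
      proof -
        have "real n * ?q * ln (1 + (\<tau> + 1) * y) \<le> l0 * ln (1 + (2 + ln (real n)) * y)"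
          using n \<tau> l assms that by (intro rate_bound_few_active) auto
        also have "\<dots> \<le> l0 * ln (1 + (2 + ln x) * y)"
        proof (intro mult_left_mono)
          have "ln (real n) \<le> ln x"
            using n M by (subst ln_le_cancel_iff) (auto simp: x)
          moreover have "0 \<le> ln (real n)"
            using n by simp
          ultimately show "ln (1 + (2 + ln (real n)) * y) \<le> ln (1 + (2 + ln x) * y)"
            using that by (subst ln_le_cancel_iff) (auto intro!: mult_right_mono add_pos_nonneg)
        qed (use assms in auto)
        finally show ?thesis .
      qed
      have "ln (1 + (\<tau> + 1) / (b / M)) \<le> ln M + ln (1 + (\<tau> + 1) * (1 / b))"
        using ln_one_plus_mult_le[of "(\<tau> + 1) / b" M] \<tau> M assms by simp
      then have "real n * ?q * (w * p) * ln (1 + (\<tau> + 1) / (b / M))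
          \<le> real n * ?q * (w * p) * (ln M + ln (1 + (\<tau> + 1) * (1 / b)))"
        using p w by (intro mult_left_mono) auto
      also have "\<dots> = real n * ?q * (w * p) * ln M + w * (p * (real n * ?q * ln (1 + (\<tau> + 1) * (1 / b))))"
        by (simp add: algebra_simps)
      also have "\<dots> \<le> c0 * ln x + w * (l0 * ln (1 + (2 + ln x) * (1 / b)))"
      proof (intro add_mono)
        have "real n * ?q * (w * p) \<le> c0"
          using few_active_coefficient[of \<alpha> ?q w n] assms w n \<tau> by (simp add: c0_def p_def)
        moreover have "ln M \<le> ln x"
          using n M by (subst ln_le_cancel_iff) (auto simp: x)
        ultimately show "real n * ?q * (w * p) * ln M \<le> c0 * ln x"
          using M c0 by (intro mult_mono) auto
        have "p * (real n * ?q * ln (1 + (\<tau> + 1) * (1 / b))) \<le> 1 * (real n * ?q * ln (1 + (\<tau> + 1) * (1 / b)))"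
          using p \<tau> assms by (intro mult_right_mono) auto
        also have "\<dots> \<le> l0 * ln (1 + (2 + ln x) * (1 / b))"
          using mono[of "1 / b"] assms by simp
        finally show "w * (p * (real n * ?q * ln (1 + (\<tau> + 1) * (1 / b)))) \<le> w * (l0 * ln (1 + (2 + ln x) * (1 / b)))"
          using w by (intro mult_left_mono) auto
      qed
      finally have "real n * (?q * (w * p * ln (1 + (\<tau> + 1) / (b / M)) + ln (1 + (\<tau> + 1) / \<eta>)))
          \<le> c0 * ln x + (w * (l0 * ln (1 + (2 + ln x) * (1 / b))) + l0 * ln (1 + (2 + ln x) * (1 / \<eta>)))"
        using mono[of "1 / \<eta>"] \<eta> by (simp add: algebra_simps)
      also have "\<dots> \<le> c0 * ln x + (c - c0) * ln x"
        using elim by (simp add: field_simps)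
      finally show "real n * (exp (- \<tau>) * (exp (z * \<eta>) * (1 - \<alpha> * exp (- \<tau>) * (z * g / (1 + z * g))) ^ (n - 1)
          * ln (1 + (\<tau> + 1) / (b / M)) + ln (1 + (\<tau> + 1) / \<eta>))) \<le> c * ln x"
        unfolding z(2) \<eta>(2) p_def by (simp add: algebra_simps)
    qed
  qed
  then show ?thesis
    using that[of z \<eta> c] z \<eta> c by auto
qed

text \<open>The condition \<open>l \<le> C * a\<close> keeps \<open>a / (p * d)\<close> away from
  zero. There \<open>ln (1 + x)\<close> lies below \<open>x\<close> by a fixed factor, which pushes
  the coefficient of \<open>a\<close> strictly below \<open>1 / d\<close>.\<close>

lemma moderately_active_bound:
  fixes d C c :: real
  assumes "0 < d" "0 < C" "0 \<le> c"
  obtains \<epsilon> \<kappa> where "0 < \<epsilon>" "\<kappa> < 1 / d"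
    "\<forall>\<^sub>F l in at_top. \<forall>p a y. l - 1 \<le> p \<longrightarrow> p \<le> l \<longrightarrow> 0 \<le> y \<longrightarrow> l \<le> C * a \<longrightarrow>
      l * ln (1 + a / (p * d)) + c * a / l + \<epsilon> * y \<le> \<kappa> * (a + y)"
proof -
  have "0 < 1 / (C * d)"
    using assms by simp
  then obtain \<rho> where \<rho>: "0 < \<rho>" "\<rho> < 1"
    and slope: "\<And>x. 1 / (C * d) \<le> x \<Longrightarrow> ln (1 + x) \<le> (1 - \<rho>) * x"
    using ln_one_plus_le_slope by blast
  \<comment> \<open>Midway between \<open>(1 - \<rho>) / d\<close> and \<open>1 / d\<close>, leaving
    room for \<open>l / (l - 1)\<close> and \<open>c / l\<close>. The same number is used for
    \<open>\<epsilon>\<close>.\<close>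
  define \<kappa> where "\<kappa> = (1 - \<rho> / 2) / d"
  have \<kappa>: "0 < \<kappa>" "\<kappa> < 1 / d" "(1 - \<rho>) / d < \<kappa>"
    using \<rho> assms by (auto simp: \<kappa>_def divide_strict_right_mono)
  have "((\<lambda>l. l / (l - 1) * ((1 - \<rho>) / d) + c / l) \<longlongrightarrow> (1 - \<rho>) / d) at_top"
    using assms \<rho> by real_asymp
  then have "\<forall>\<^sub>F l in at_top. l / (l - 1) * ((1 - \<rho>) / d) + c / l < \<kappa>"
    by (rule order_tendstoD(2)[OF _ \<kappa>(3)])
  then have "\<forall>\<^sub>F l in at_top. \<forall>p a y. l - 1 \<le> p \<longrightarrow> p \<le> l \<longrightarrow> 0 \<le> y \<longrightarrow> l \<le> C * a \<longrightarrow>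
      l * ln (1 + a / (p * d)) + c * a / l + \<kappa> * y \<le> \<kappa> * (a + y)"
    using eventually_gt_at_top[of "1 :: real"]
  proof eventually_elim
    case (elim l)
    show ?case
    proof (intro allI impI)
      fix p a y :: real
      assume p: "l - 1 \<le> p" "p \<le> l" and y: "0 \<le> y" and l: "l \<le> C * a"
      have "0 < C * a"
        using elim l by linarith
      then have pos: "0 < p" "0 < a"
        using p elim assms zero_less_mult_pos by auto
      have "p \<le> C * a"
        using p l by linarith
      then have "1 / (C * d) \<le> a / (p * d)"
        using pos assms by (simp add: field_simps)
      from slope[OF this] have "l * ln (1 + a / (p * d)) \<le> l * ((1 - \<rho>) * (a / (p * d)))"
        using elim by (intro mult_left_mono) auto
      also have "\<dots> = l / p * ((1 - \<rho>) / d * a)"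
        by simp
      also have "\<dots> \<le> l / (l - 1) * ((1 - \<rho>) / d * a)"
        using p elim pos \<rho> assms by (intro mult_right_mono divide_left_mono) auto
      finally have "l * ln (1 + a / (p * d)) + c * a / l \<le> (l / (l - 1) * ((1 - \<rho>) / d) + c / l) * a"
        by (simp add: algebra_simps)
      also have "\<dots> \<le> \<kappa> * a"
        using elim pos by (intro mult_right_mono) auto
      finally show "l * ln (1 + a / (p * d)) + c * a / l + \<kappa> * y \<le> \<kappa> * (a + y)"
        by (simp add: algebra_simps)
    qed
  qed
  then show ?thesis
    using that \<kappa> by blast
qed

text \<open>Since \<open>8 * a \<le> l \<le> y\<close>, the inequality
  \<open>ln (1 + x) \<le> x\<close> bounds the first term by \<open>y / (4 * d)\<close>. The other
  two terms take at most \<open>y / (8 * d)\<close> each.\<close>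

lemma many_clusters_bound:
  fixes d C c \<epsilon> l p a y :: real
  assumes "0 < d" "8 \<le> C" "8 * c * d \<le> C" "0 \<le> c" "\<epsilon> \<le> 1 / (8 * d)"
    and "2 \<le> l" "l - 1 \<le> p" "C * a \<le> l" "l \<le> y" "0 \<le> a"
  shows "l * ln (1 + a / (p * d)) + c * a / l + \<epsilon> * y \<le> 1 / (2 * d) * y"
proof -
  have p: "l / 2 \<le> p" "0 < p"
    using assms by auto
  have "l * ln (1 + a / (p * d)) \<le> l * (a / (p * d))"
    using assms p by (intro mult_left_mono ln_add_one_self_le_self) auto
  also have "\<dots> \<le> l * (a / (l / 2 * d))"
    using assms p by (intro mult_left_mono divide_left_mono mult_right_mono) auto
  also have "\<dots> = 2 * a / d"
    using assms by simp
  also have "\<dots> \<le> 2 * (y / 8) / d"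
    using assms mult_right_mono[of 8 C a] by (intro divide_right_mono mult_left_mono) auto
  finally have 1: "l * ln (1 + a / (p * d)) \<le> 1 / (4 * d) * y" by simp
  have "c * a / l * (8 * d) = 8 * c * d * a / l"
    by simp
  also have "\<dots> \<le> C * a / l"
    using assms by (intro divide_right_mono mult_right_mono) auto
  also have "\<dots> \<le> 1"
    using assms by (simp add: divide_le_eq)
  also have "\<dots> \<le> y"
    using assms by simp
  finally have 2: "c * a / l \<le> 1 / (8 * d) * y"
    using assms by (simp add: field_simps)
  have "\<epsilon> * y \<le> 1 / (8 * d) * y"
    using assms by (intro mult_right_mono) auto
  then have "l * ln (1 + a / (p * d)) + c * a / l + \<epsilon> * y \<le> (1 / (4 * d) + 1 / (8 * d) + 1 / (8 * d)) * y"
    using 1 2 by (simp only: distrib_right)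
  also have "1 / (4 * d) + 1 / (8 * d) + 1 / (8 * d) = 1 / (2 * d)"
    by (simp add: field_simps)
  finally show ?thesis .
qed

text \<open>\<open>m = p * d\<close> is the mean interference in one of the \<open>M\<close>
  clusters and \<open>B = l * d + b\<close> bounds noise plus mean interference after merging. They
  differ by at most \<open>d + b\<close>, while the signal grows by \<open>y = ln M\<close>; the
  gain \<open>e * y\<close> pays for all errors and leaves \<open>e / 8\<close>.\<close>

lemma merged_cluster_gain:
  fixes d b C c \<epsilon> e l p a y :: real
  assumes e: "e = 1 / (2 * (d + b + 2))"
    and "0 < d" "0 < b" "0 \<le> c"
    and C: "1 \<le> C" "8 * (d + b) / d \<le> C" "8 * c / e \<le> C"
    and \<epsilon>: "\<epsilon> \<le> e / 4"
    and l: "2 \<le> l" "16 / (d\<^sup>2 * e) \<le> l"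
    and p: "l - 1 \<le> p" "p \<le> l"
    and a: "0 \<le> a" "C * a \<le> l" and y: "1 / 2 \<le> y" "y \<le> l"
  shows "l * ln (1 + a / (p * d)) + c * a / l + \<epsilon> * y + e / 8
    \<le> l * (ln (1 + (a + y) / (l * d + b)) - 2 / (l * d + b + (a + y))\<^sup>2)"
proof -
  define B where "B = l * d + b"
  define m where "m = p * d"
  have e0: "0 < e"
    using assms by simp
  have "0 < l * d"
    using l assms(2) by simp
  then have B: "0 < B" "l * d \<le> B"
    using assms(3) by (auto simp: B_def)
  have m: "0 < m" "l * d / 2 \<le> m" "B - m \<le> d + b"
  proof -
    show "l * d / 2 \<le> m"
      using assms mult_right_mono[of "l / 2" p d] by (auto simp: m_def)
    then show "0 < m"
      using \<open>0 < l * d\<close> by linarith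
    show "B - m \<le> d + b"
      using assms mult_right_mono[of "l - 1" p d] by (auto simp: m_def B_def algebra_simps)
  qed
  \<comment> \<open>The loss from the larger interference is at most \<open>1 / 4\<close>, hence at
    most half of \<open>y\<close>; this is what the lower bound \<open>8 * (d + b) / d\<close> on
    \<open>C\<close> is for.\<close>
  have "a * (B - m) / m \<le> a * (d + b) / m"
    using m a by (intro divide_right_mono mult_left_mono) auto
  also have "\<dots> \<le> a * (d + b) / (l * d / 2)"
    using m a assms by (intro divide_left_mono) auto
  also have "\<dots> = 1 / 4 * (8 * (d + b) / d * a) / l"
    using \<open>0 < l * d\<close> by (simp add: divide_simps; simp add: algebra_simps)
  also have "\<dots> \<le> 1 / 4 * (C * a) / l"
    using C a l by (intro divide_right_mono mult_left_mono mult_right_mono) auto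
  also have "\<dots> \<le> 1 / 4"
    using a l by simp
  finally have num: "y / 2 \<le> y - a * (B - m) / m"
    using y by linarith
  have "a \<le> l"
    using a C mult_right_mono[of 1 C a] by simp
  moreover have "b \<le> l * b"
    using l assms(3) by simp
  ultimately have den: "B + (a + y) \<le> l * (d + b + 2)"
    using y(2) by (simp add: B_def algebra_simps)
  have "e * y = l * ((y / 2) / (l * (d + b + 2)))"
    using l by (simp add: e)
  also have "\<dots> \<le> l * ((y / 2) / (B + (a + y)))"
    using den B a y l assms by (intro mult_left_mono divide_left_mono) auto
  also have "\<dots> \<le> l * ((y - a * (B - m) / m) / (B + (a + y)))"
    using num B a y l by (intro mult_left_mono divide_right_mono) auto
  \<comment> \<open>The form \<open>1 - 1 / z\<close>, where \<open>z\<close> is the ratio of the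
    two arguments of the logarithm; it bounds \<open>ln z\<close> from below.\<close>
  also have "(y - a * (B - m) / m) / (B + (a + y)) = 1 - 1 / ((1 + (a + y) / B) / (1 + a / m))"
  proof -
    have "1 / ((1 + (a + y) / B) / (1 + a / m)) = (m + a) * B / (m * (B + (a + y)))"
      using B m a y by (simp add: field_simps)
    moreover have "(y - a * (B - m) / m) / (B + (a + y)) = 1 - (m + a) * B / (m * (B + (a + y)))"
      using B m a y by (simp add: divide_simps; simp add: algebra_simps)
    ultimately show ?thesis by simp
  qed
  also have "l * \<dots> \<le> l * ln ((1 + (a + y) / B) / (1 + a / m))"
    using B m a y l by (intro mult_left_mono ln_ge_one_minus_inverse divide_pos_pos add_pos_nonneg) auto
  also have "\<dots> = l * ln (1 + (a + y) / B) - l * ln (1 + a / m)"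
    using B m a y by (subst ln_divide_pos) (auto intro!: add_pos_nonneg simp: algebra_simps)
  finally have gain: "e * y \<le> l * ln (1 + (a + y) / B) - l * ln (1 + a / m)" .
  have "l * (2 / (B + (a + y))\<^sup>2) \<le> l * (2 / (l * d)\<^sup>2)"
    using B a y l assms by (intro mult_left_mono divide_left_mono power_mono) auto
  also have "\<dots> = (2 / d\<^sup>2) / l"
    using l by (simp add: power2_eq_square)
  also have "\<dots> \<le> e / 8"
    using l e0 assms(2) by (simp add: field_simps)
  finally have quad: "l * (2 / (B + (a + y))\<^sup>2) \<le> e / 8" .
  have "c * a / l * 8 = e * (8 * c / e * a) / l"
    using e0 by simp
  also have "\<dots> \<le> e * (C * a) / l"
    using C a l e0 by (intro divide_right_mono mult_left_mono mult_right_mono) auto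
  also have "\<dots> \<le> e"
    using a l e0 by (simp add: divide_le_eq)
  finally have "c * a / l \<le> e / 8" by simp
  moreover have "\<epsilon> * y \<le> e / 4 * y"
    using \<epsilon> y by (intro mult_right_mono) auto
  moreover have "e * (1 / 2) \<le> e * y"
    using y e0 by (intro mult_left_mono) auto
  \<comment> \<open>Of the gain \<open>e * y\<close>, a quarter covers
    \<open>\<epsilon> * y\<close>, and two errors cost \<open>e / 8\<close> each. With
    \<open>y \<ge> 1 / 2\<close> there remains at least
    \<open>3 * e / 8 - e / 4 = e / 8\<close>.\<close>
  ultimately have "l * ln (1 + a / m) + c * a / l + \<epsilon> * y + e / 8
      \<le> l * ln (1 + (a + y) / B) - l * (2 / (B + (a + y))\<^sup>2)"
    using gain quad by linarith
  then show ?thesis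
    by (simp add: m_def B_def right_diff_distrib)
qed

lemma single_cluster_growth:
  fixes f :: "nat \<Rightarrow> real \<Rightarrow> real" and b d \<kappa> :: real
  assumes "0 < d" "0 < b" "\<kappa> < 1 / d"
    and lower: "\<And>K \<tau> B. 0 \<le> \<tau> \<Longrightarrow> 2 \<le> B + (\<tau> + 1) \<Longrightarrow> real K * exp (- \<tau>) * d + b \<le> B \<Longrightarrow>
      real K * (exp (- \<tau>) * (ln (1 + (\<tau> + 1) / B) - 2 / (B + (\<tau> + 1))\<^sup>2)) \<le> f K \<tau>"
  shows "\<forall>\<^sub>F K in sequentially. \<exists>\<tau>. \<kappa> * ln (real K) \<le> f K \<tau>"
proof -
  \<comment> \<open>This threshold makes \<open>x * exp (- t x) = (ln x)^2\<close>. Then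
    \<open>t x + 1\<close> is of order \<open>ln x\<close> and \<open>B x\<close> of order
    \<open>d * (ln x)^2\<close>, so the logarithm behaves like \<open>1 / (d * ln x)\<close> and the
    normalised rate tends to \<open>1 / d\<close>.\<close>
  define t where "t x = ln x - 2 * ln (ln x)" for x :: real
  define B where "B x = (ln x)\<^sup>2 * d + b" for x :: real
  have "((\<lambda>x. (ln x)\<^sup>2 * (ln (1 + (t x + 1) / B x) - 2 / (B x + (t x + 1))\<^sup>2) / ln x) \<longlongrightarrow> inverse d) at_top"
    using assms(1,2) unfolding t_def B_def by real_asymp
  then have "\<forall>\<^sub>F x in at_top. \<kappa> < (ln x)\<^sup>2 * (ln (1 + (t x + 1) / B x) - 2 / (B x + (t x + 1))\<^sup>2) / ln x"
    by (rule order_tendstoD(1)) (use assms(3) in \<open>simp add: inverse_eq_divide\<close>)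
  moreover have "\<forall>\<^sub>F x in at_top. 0 \<le> t x"
    unfolding t_def by real_asymp
  moreover have "\<forall>\<^sub>F x in at_top. 2 \<le> B x + (t x + 1)"
    using assms(1,2) unfolding t_def B_def by real_asymp
  ultimately have "\<forall>\<^sub>F x in at_top. \<kappa> * ln x \<le> (ln x)\<^sup>2 * (ln (1 + (t x + 1) / B x) - 2 / (B x + (t x + 1))\<^sup>2)
      \<and> 0 \<le> t x \<and> 2 \<le> B x + (t x + 1) \<and> x * exp (- t x) = (ln x)\<^sup>2"
    using eventually_gt_at_top[of "1::real"]
  proof eventually_elim
    case (elim x)
    have lx: "0 < ln x"
      using elim by simp
    then have "exp (2 * ln (ln x)) = (ln x)\<^sup>2"
      by (simp add: exp_double)
    then have "x * exp (- t x) = (ln x)\<^sup>2"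
      using elim lx by (simp add: t_def exp_diff exp_minus)
    then show ?case
      using elim lx by (simp add: field_simps)
  qed
  then have "\<forall>\<^sub>F K in sequentially. \<kappa> * ln (real K) \<le> (ln (real K))\<^sup>2 *
        (ln (1 + (t (real K) + 1) / B (real K)) - 2 / (B (real K) + (t (real K) + 1))\<^sup>2)
      \<and> 0 \<le> t (real K) \<and> 2 \<le> B (real K) + (t (real K) + 1) \<and> real K * exp (- t (real K)) = (ln (real K))\<^sup>2"
    by (rule eventually_compose_filterlim[OF _ filterlim_real_sequentially])
  then show ?thesis
  proof eventually_elim
    case (elim K)
    have "real K * (exp (- t (real K)) * (ln (1 + (t (real K) + 1) / B (real K))
        - 2 / (B (real K) + (t (real K) + 1))\<^sup>2)) \<le> f K (t (real K))"
      using elim by (intro lower) (auto simp: B_def)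
    then have "\<kappa> * ln (real K) \<le> f K (t (real K))"
      using elim by (simp add: mult.assoc[symmetric])
    then show ?case ..
  qed
qed

text \<open>\<open>f\<close> stands for the average sum-rate divided by \<open>W\<close>, and only
  the three probabilistic bounds enter. The gap \<open>\<delta>\<close> is independent of
  \<open>M\<close> and \<open>\<tau>\<close>, so that it survives taking suprema over
  thresholds.\<close>

lemma single_cluster_dominates:
  fixes f :: "nat \<Rightarrow> nat \<Rightarrow> real \<Rightarrow> real" and \<alpha> b c d g :: real
  assumes \<alpha>: "0 < \<alpha>" "\<alpha> < 1" and d: "0 < d" "d \<le> \<alpha>" and b: "0 < b" and g: "0 < g" and c: "0 \<le> c"
    and concentrated: "\<And>K M \<tau>. 0 \<le> \<tau> \<Longrightarrow> 0 < M \<Longrightarrow> 2 \<le> K div M \<Longrightarrow>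
      f K M \<tau> \<le> real (K div M) * (exp (- \<tau>) * (ln (1 + (\<tau> + 1) / ((real (K div M) - 1) * exp (- \<tau>) * d))
        + c * (\<tau> + 1) / ((real (K div M) - 1) * exp (- \<tau>) * d)\<^sup>2
        + exp (- (\<alpha> / 12) * ((real (K div M) - 1) * exp (- \<tau>))) * ln (1 + (\<tau> + 1) / (b / real M))))"
    and split: "\<And>K M \<tau> z \<eta>. 0 \<le> \<tau> \<Longrightarrow> 0 < M \<Longrightarrow> 0 \<le> z \<Longrightarrow> 0 < \<eta> \<Longrightarrow>
      f K M \<tau> \<le> real (K div M) * (exp (- \<tau>) *
        (exp (z * \<eta>) * (1 - \<alpha> * exp (- \<tau>) * (z * g / (1 + z * g))) ^ (K div M - 1)
          * ln (1 + (\<tau> + 1) / (b / real M)) + ln (1 + (\<tau> + 1) / \<eta>)))"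
    and lower: "\<And>K \<tau> B. 0 \<le> \<tau> \<Longrightarrow> 2 \<le> B + (\<tau> + 1) \<Longrightarrow> real K * exp (- \<tau>) * d + b \<le> B \<Longrightarrow>
      real K * (exp (- \<tau>) * (ln (1 + (\<tau> + 1) / B) - 2 / (B + (\<tau> + 1))\<^sup>2)) \<le> f K 1 \<tau>"
  shows "\<exists>\<delta>>0. \<forall>\<^sub>F K in sequentially. \<forall>M \<tau>. 2 \<le> M \<longrightarrow> M dvd K \<longrightarrow> 0 \<le> \<tau> \<longrightarrow>
    (\<exists>\<tau>'. f K M \<tau> + \<delta> \<le> f K 1 \<tau>')"
proof -
  define e where "e = 1 / (2 * (d + b + 2))"
  define c4 where "c4 = 4 * c / d\<^sup>2 + 1 / b"
  \<comment> \<open>The entries are the lower bounds on \<open>C\<close> required by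
    \<open>many_clusters_bound\<close> and \<open>merged_cluster_gain\<close>. \<open>C\<close>
    precedes \<open>\<epsilon>\<close>, since \<open>\<epsilon>1\<close> depends on it.\<close>
  define C where "C = Max {8, 8 * (d + b) / d, 8 * c4 / e, 8 * c4 * d}"
  have e: "0 < e" and c4: "0 \<le> c4"
    using d b c by (auto simp: e_def c4_def)
  have C: "8 \<le> C" "8 * (d + b) / d \<le> C" "8 * c4 / e \<le> C" "8 * c4 * d \<le> C"
    by (auto simp: C_def)
  have "0 < C"
    using C by simp
  then obtain \<epsilon>1 \<kappa>1 where \<epsilon>1: "0 < \<epsilon>1" and \<kappa>1: "\<kappa>1 < 1 / d"
    and moderate: "\<forall>\<^sub>F l in at_top. \<forall>p a y. l - 1 \<le> p \<longrightarrow> p \<le> l \<longrightarrow> 0 \<le> y \<longrightarrow> l \<le> C * a \<longrightarrow>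
      l * ln (1 + a / (p * d)) + c4 * a / l + \<epsilon>1 * y \<le> \<kappa>1 * (a + y)"
    using moderately_active_bound[OF d(1) _ c4] by blast
  define \<epsilon> where "\<epsilon> = Min {\<epsilon>1, e / 4, 1 / (8 * d)}"
  have \<epsilon>: "0 < \<epsilon>" "\<epsilon> \<le> \<epsilon>1" "\<epsilon> \<le> e / 4" "\<epsilon> \<le> 1 / (8 * d)"
    using \<epsilon>1 e d by (auto simp: \<epsilon>_def)
  have "0 < \<alpha> / 12"
    using \<alpha> by simp
  \<comment> \<open>From \<open>l0\<close> on, all estimates for many active users hold at once;
    values up to \<open>l1\<close>, which is \<open>l0\<close> raised to at least 1, are left to
    \<open>few_active_bound\<close>.\<close>
  note ev = concentrated_bound_simplified[OF d(1) b this c \<epsilon>(1), folded c4_def] moderate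
    eventually_ge_at_top[of "Max {2, 16 / (d\<^sup>2 * e), 2 / d}"]
  from eventually_conj[OF ev(1) eventually_conj[OF ev(2,3)]]
  obtain l0 where l0: "\<And>l. l0 \<le> l \<Longrightarrow> (\<forall>p a M. l - 1 \<le> p \<longrightarrow> 0 \<le> a \<longrightarrow> 1 \<le> M \<longrightarrow>
        l * (ln (1 + a / (p * d)) + c * a / (p * d)\<^sup>2 + exp (- (\<alpha> / 12) * p) * ln (1 + a / (b / M)))
        \<le> l * ln (1 + a / (p * d)) + c4 * a / l + \<epsilon> * ln M) \<and>
      (\<forall>p a y. l - 1 \<le> p \<longrightarrow> p \<le> l \<longrightarrow> 0 \<le> y \<longrightarrow> l \<le> C * a \<longrightarrow>
        l * ln (1 + a / (p * d)) + c4 * a / l + \<epsilon>1 * y \<le> \<kappa>1 * (a + y)) \<and>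
      Max {2, 16 / (d\<^sup>2 * e), 2 / d} \<le> l"
    unfolding eventually_at_top_linorder by blast
  define l1 where "l1 = max 1 l0"
  have "1 \<le> l1"
    by (simp add: l1_def)
  obtain z \<eta> \<kappa>2 where z: "0 \<le> z" "0 < \<eta>" and \<kappa>2: "\<kappa>2 < 1 / \<alpha>"
    and few: "\<forall>\<^sub>F x in at_top. \<forall>(n::nat) M \<tau>. 1 \<le> n \<longrightarrow> 1 \<le> M \<longrightarrow> x = real n * M \<longrightarrow> 0 \<le> \<tau> \<longrightarrow>
      real n * exp (- \<tau>) \<le> l1 \<longrightarrow>
      real n * (exp (- \<tau>) * (exp (z * \<eta>) * (1 - \<alpha> * exp (- \<tau>) * (z * g / (1 + z * g))) ^ (n - 1)
        * ln (1 + (\<tau> + 1) / (b / M)) + ln (1 + (\<tau> + 1) / \<eta>))) \<le> \<kappa>2 * ln x"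
    by (rule few_active_bound[OF \<alpha> g b \<open>1 \<le> l1\<close>])
  define \<kappa>3 where "\<kappa>3 = Max {\<kappa>1, \<kappa>2, 1 / (2 * d)}"
  have "1 / \<alpha> \<le> 1 / d"
    using d \<alpha> by (intro divide_left_mono) auto
  then have \<kappa>3: "\<kappa>1 \<le> \<kappa>3" "\<kappa>2 \<le> \<kappa>3" "1 / (2 * d) \<le> \<kappa>3" "\<kappa>3 < 1 / d"
    using \<kappa>1 \<kappa>2 d by (auto simp: \<kappa>3_def divide_strict_left_mono)
  have "0 < 1 / (2 * d)"
    using d by simp
  then have \<kappa>3_pos: "0 < \<kappa>3"
    using \<kappa>3(3) by linarith
  \<comment> \<open>The distance from \<open>\<kappa>3\<close> to \<open>\<kappa>4\<close>,
    multiplied by \<open>ln K\<close>, eventually exceeds the constants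
    \<open>\<kappa>3 + e / 8\<close>.\<close>
  obtain \<kappa>4 where \<kappa>4: "\<kappa>3 < \<kappa>4" "\<kappa>4 < 1 / d"
    using dense[OF \<kappa>3(4)] by blast
  have grow: "\<forall>\<^sub>F K in sequentially. \<exists>\<tau>. \<kappa>4 * ln (real K) \<le> f K 1 \<tau>"
    using d(1) b \<kappa>4(2) lower by (rule single_cluster_growth)
  have few': "\<forall>\<^sub>F K in sequentially. \<forall>(n::nat) M \<tau>. 1 \<le> n \<longrightarrow> 1 \<le> M \<longrightarrow> real K = real n * M \<longrightarrow> 0 \<le> \<tau> \<longrightarrow>
      real n * exp (- \<tau>) \<le> l1 \<longrightarrow>
      real n * (exp (- \<tau>) * (exp (z * \<eta>) * (1 - \<alpha> * exp (- \<tau>) * (z * g / (1 + z * g))) ^ (n - 1)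
        * ln (1 + (\<tau> + 1) / (b / M)) + ln (1 + (\<tau> + 1) / \<eta>))) \<le> \<kappa>2 * ln (real K)"
    by (rule eventually_compose_filterlim[OF few filterlim_real_sequentially])
  have gap: "\<forall>\<^sub>F K in sequentially. \<kappa>3 * (1 + ln (real K)) + e / 8 \<le> \<kappa>4 * ln (real K)"
    using \<kappa>4(1) by real_asymp
  have "\<forall>\<^sub>F K in sequentially. \<forall>M \<tau>. 2 \<le> M \<longrightarrow> M dvd K \<longrightarrow> 0 \<le> \<tau> \<longrightarrow>
      (\<exists>\<tau>'. f K M \<tau> + e / 8 \<le> f K 1 \<tau>')"
    using grow few' gap eventually_gt_at_top[of 0]
  proof eventually_elim
    case (elim K)
    obtain \<tau>1 where \<tau>1: "\<kappa>4 * ln (real K) \<le> f K 1 \<tau>1"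
      using elim by blast
    have crude: "\<exists>\<tau>'. r + e / 8 \<le> f K 1 \<tau>'" if "r \<le> \<kappa>3 * (1 + ln (real K))" for r
      using that \<tau>1 elim(3) by (intro exI[of _ \<tau>1]) linarith
    show ?case
    proof (intro allI impI)
      fix M :: nat and \<tau> :: real
      assume M: "2 \<le> M" "M dvd K" and \<tau>: "0 \<le> \<tau>"
      define n where "n = K div M"
      define l where "l = real n * exp (- \<tau>)"
      define p where "p = (real n - 1) * exp (- \<tau>)"
      define a where "a = \<tau> + 1"
      define y where "y = ln (real M)"
      have K: "real K = real n * real M"
        using M by (simp add: n_def flip: of_nat_mult)
      have n: "1 \<le> n"
        using K elim(4) by (cases n) auto
      have "exp (- \<tau>) \<le> 1"
        using \<tau> by simp
      then have p: "l - 1 \<le> p" "p \<le> l"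
        by (auto simp: p_def l_def algebra_simps)
      have a: "1 \<le> a"
        using \<tau> by (simp add: a_def)
      have y: "1 / 2 \<le> y"
      proof -
        have "1 - 1 / real M \<le> y"
          unfolding y_def using M by (intro ln_ge_one_minus_inverse) auto
        moreover have "1 / real M \<le> 1 / 2"
          using M by (intro divide_left_mono) auto
        ultimately show ?thesis by linarith
      qed
      have lnK: "ln (real K) = ln (real n) + y"
        using n M by (simp add: K y_def ln_mult_pos)
      have lnn: "0 \<le> ln (real n)"
        using n by simp
      show "\<exists>\<tau>'. f K M \<tau> + e / 8 \<le> f K 1 \<tau>'"
      proof (cases "l \<le> l1")
        case True
        have "f K M \<tau> \<le> real n * (exp (- \<tau>) *
            (exp (z * \<eta>) * (1 - \<alpha> * exp (- \<tau>) * (z * g / (1 + z * g))) ^ (n - 1)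
              * ln (1 + (\<tau> + 1) / (b / real M)) + ln (1 + (\<tau> + 1) / \<eta>)))"
          unfolding n_def by (rule split[OF \<tau> _ z]) (use M in simp)
        also have "\<dots> \<le> \<kappa>2 * ln (real K)"
          by (rule elim(2)[rule_format, OF n _ K \<tau> True[unfolded l_def]]) (use M in simp)
        also have "\<dots> \<le> \<kappa>3 * (1 + ln (real K))"
          using \<kappa>3(2) \<kappa>3_pos lnK lnn y by (intro mult_mono) auto
        finally show ?thesis
          by (rule crude)
      next
        case False
        then have l: "l0 \<le> l" "1 \<le> l"
          by (auto simp: l1_def)
        note L = l0[OF l(1)]
        have l2: "2 \<le> l" "16 / (d\<^sup>2 * e) \<le> l" "2 / d \<le> l"
          using L by auto
        have "l \<le> real n * 1"
          unfolding l_def using \<tau> by (intro mult_left_mono) auto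
        then have n2: "2 \<le> n"
          using l2 by linarith
        have "f K M \<tau> \<le> l * (ln (1 + a / (p * d)) + c * a / (p * d)\<^sup>2 + exp (- (\<alpha> / 12) * p) * ln (1 + a / (b / real M)))"
          using concentrated[OF \<tau>, of M K] M n2
          unfolding n_def[symmetric] p_def l_def a_def by (simp add: mult.assoc)
        also have "\<dots> \<le> l * ln (1 + a / (p * d)) + c4 * a / l + \<epsilon> * y"
          using L p a M unfolding y_def by auto
        finally have le: "f K M \<tau> \<le> l * ln (1 + a / (p * d)) + c4 * a / l + \<epsilon> * y" .
        \<comment> \<open>The first two cases stay below the growth rate of a single cluster. In the
          third, \<open>l\<close> exceeds both \<open>a\<close> (by the factor \<open>C\<close>) and
          \<open>ln M\<close>, and merging the clusters gives the gain.\<close>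
        consider "l \<le> C * a" | "C * a \<le> l" "l \<le> y" | "C * a \<le> l" "y \<le> l"
          by linarith
        then show ?thesis
        proof cases
          case 1
          note le
          also have "l * ln (1 + a / (p * d)) + c4 * a / l + \<epsilon> * y
              \<le> l * ln (1 + a / (p * d)) + c4 * a / l + \<epsilon>1 * y"
            using \<epsilon>(2) y by (intro add_left_mono mult_right_mono) auto
          also have "\<dots> \<le> \<kappa>1 * (a + y)"
            using L p 1 y by auto
          also have "\<dots> \<le> \<kappa>3 * (1 + ln (real K))"
          proof (rule mult_mono)
            \<comment> \<open>At least one expected active user means
              \<open>\<tau> \<le> ln n\<close>, which turns \<open>a + y\<close> into
              \<open>1 + ln K\<close>.\<close>
            have "0 \<le> ln l"
              using l by simp
            also have "ln l = ln (real n) - \<tau>"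
              using n by (simp add: l_def ln_mult_pos)
            finally show "a + y \<le> 1 + ln (real K)"
              by (simp add: a_def lnK)
          qed (use \<kappa>3 \<kappa>3_pos a y in auto)
          finally show ?thesis
            by (rule crude)
        next
          case 2
          note le
          also have "l * ln (1 + a / (p * d)) + c4 * a / l + \<epsilon> * y \<le> 1 / (2 * d) * y"
            using d C c4 \<epsilon> l2 p 2 a by (intro many_clusters_bound) auto
          also have "\<dots> \<le> \<kappa>3 * (1 + ln (real K))"
            using \<kappa>3 \<kappa>3_pos y lnK lnn by (intro mult_mono) auto
          finally show ?thesis
            by (rule crude)
        next
          case 3
          \<comment> \<open>Raising the threshold by \<open>ln M\<close> keeps the expected number of active users at \<open>l\<close>.\<close>
          have q: "real K * exp (- (\<tau> + y)) = l"
            using M by (simp add: K l_def y_def exp_diff exp_minus field_simps)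
          have "f K M \<tau> + e / 8 \<le> l * ln (1 + a / (p * d)) + c4 * a / l + \<epsilon> * y + e / 8"
            using le by simp
          also have "\<dots> \<le> l * (ln (1 + (a + y) / (l * d + b)) - 2 / (l * d + b + (a + y))\<^sup>2)"
            using d b C c4 \<epsilon> l2 p a 3 y by (intro merged_cluster_gain[OF e_def]) auto
          also have "\<dots> = real K * (exp (- (\<tau> + y)) * (ln (1 + (\<tau> + y + 1) / (l * d + b))
              - 2 / (l * d + b + (\<tau> + y + 1))\<^sup>2))"
            unfolding mult.assoc[symmetric] q by (simp add: a_def add_ac)
          also have "\<dots> \<le> f K 1 (\<tau> + y)"
          proof (rule lower)
            have "2 \<le> l * d"
              using l2(3) d by (simp add: divide_le_eq)
            then show "2 \<le> l * d + b + (\<tau> + y + 1)"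
              using b \<tau> y by linarith
          qed (use \<tau> y q in auto)
          finally show ?thesis ..
        qed
      qed
    qed
  qed
  then show ?thesis
    using e by (intro exI[of _ "e / 8"]) auto
qed

subsection \<open>Rate of a link with exponential fading and independent interference\<close>

context prob_space begin

text \<open>The fundamental theorem of calculus on a half-line, with \<open>F\<close> the
  antiderivative vanishing at infinity. Nonnegativity of the integrand yields integrability together
  with the value.\<close>

lemma exponential_tail_integral:
  fixes F g :: "real \<Rightarrow> real"
  assumes D: "distributed M lborel X (exponential_density 1)"
    and [measurable]: "g \<in> borel_measurable borel"
    and g: "\<And>x. \<tau> \<le> x \<Longrightarrow> 0 \<le> g x" and \<tau>: "0 \<le> \<tau>"
    and F: "\<And>x. (F has_real_derivative exp (- x) * g x) (at x)"
    and lim: "(F \<longlongrightarrow> 0) at_top"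
  shows "has_bochner_integral M (\<lambda>\<omega>. of_bool (\<tau> < X \<omega>) * g (X \<omega>)) (- F \<tau>)"
proof -
  have [measurable]: "X \<in> borel_measurable M"
    using distributed_measurable[OF D] by simp
  have "(\<integral>\<^sup>+\<omega>. ennreal (of_bool (\<tau> < X \<omega>) * g (X \<omega>)) \<partial>M)
      = (\<integral>\<^sup>+x. ennreal (exponential_density 1 x) * ennreal (of_bool (\<tau> < x) * g x) \<partial>lborel)"
    by (rule distributed_nn_integral[OF D, symmetric]) simp
  also have "\<dots> = (\<integral>\<^sup>+x. ennreal (exp (- x) * g x) * indicator {\<tau> ..} x \<partial>lborel)"
  proof (rule nn_integral_cong_AE)
    \<comment> \<open>The strict threshold and the closed half-line differ only at the null point
      \<open>\<tau>\<close>.\<close>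
    have "AE x in lborel. x \<noteq> \<tau>"
      by (rule AE_lborel_singleton)
    then show "AE x in lborel. ennreal (exponential_density 1 x) * ennreal (of_bool (\<tau> < x) * g x)
        = ennreal (exp (- x) * g x) * indicator {\<tau> ..} x"
      by eventually_elim
        (use \<tau> in \<open>auto simp: exponential_density_def ennreal_mult' g split: split_indicator\<close>)
  qed
  also have "\<dots> = ennreal (0 - F \<tau>)"
    by (rule nn_integral_FTC_atLeast) (auto intro!: F lim mult_nonneg_nonneg g)
  finally have *: "(\<integral>\<^sup>+\<omega>. ennreal (of_bool (\<tau> < X \<omega>) * g (X \<omega>)) \<partial>M) = ennreal (- F \<tau>)"
    by simp
  have mono: "F \<tau> \<le> F x" if "\<tau> \<le> x" for x
    by (rule DERIV_nonneg_imp_nondecreasing[OF that]) (auto intro!: exI F mult_nonneg_nonneg g)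
  have "F \<tau> \<le> 0"
    by (rule tendsto_lowerbound[OF lim])
      (auto simp: eventually_at_top_linorder intro!: exI[of _ \<tau>] mono)
  then show ?thesis
    by (intro has_bochner_integral_nn_integral *) (auto simp: g)
qed

text \<open>Absence of memory: given \<open>X > \<tau>\<close>, the excess \<open>X - \<tau>\<close>
  is again exponential, hence the conditional mean \<open>\<tau> + 1\<close> and the conditional
  variance 1.\<close>

lemma exponential_tail_moments:
  assumes D: "distributed M lborel X (exponential_density 1)" and \<tau>: "0 \<le> \<tau>"
  shows "has_bochner_integral M (\<lambda>\<omega>. of_bool (\<tau> < X \<omega>)) (exp (- \<tau>))"
    and "has_bochner_integral M (\<lambda>\<omega>. of_bool (\<tau> < X \<omega>) * X \<omega>) (exp (- \<tau>) * (\<tau> + 1))"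
    and "has_bochner_integral M (\<lambda>\<omega>. of_bool (\<tau> < X \<omega>) * (X \<omega> - (\<tau> + 1))\<^sup>2) (exp (- \<tau>))"
proof -
  have "((\<lambda>x::real. - exp (- x)) \<longlongrightarrow> 0) at_top"
    by real_asymp
  moreover have "((\<lambda>x::real. - exp (- x)) has_real_derivative exp (- x)) (at x)" for x
    by (auto intro!: derivative_eq_intros)
  ultimately show "has_bochner_integral M (\<lambda>\<omega>. of_bool (\<tau> < X \<omega>)) (exp (- \<tau>))"
    using exponential_tail_integral[OF D, of "\<lambda>_. 1" \<tau> "\<lambda>x. - exp (- x)"] \<tau> by simp
  have "((\<lambda>x::real. - exp (- x) * (x + 1)) \<longlongrightarrow> 0) at_top"
    by real_asymp
  moreover have "((\<lambda>x. - exp (- x) * (x + 1)) has_real_derivative exp (- x) * x) (at x)" for x :: real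
    by (auto intro!: derivative_eq_intros simp: algebra_simps)
  ultimately show "has_bochner_integral M (\<lambda>\<omega>. of_bool (\<tau> < X \<omega>) * X \<omega>) (exp (- \<tau>) * (\<tau> + 1))"
    using exponential_tail_integral[OF D, of "\<lambda>x. x" \<tau> "\<lambda>x. - exp (- x) * (x + 1)"] \<tau> by simp
  have "((\<lambda>x::real. - exp (- x) * ((x - \<tau>)\<^sup>2 + 1)) \<longlongrightarrow> 0) at_top"
    by real_asymp
  moreover have "((\<lambda>x. - exp (- x) * ((x - \<tau>)\<^sup>2 + 1)) has_real_derivative
      exp (- x) * (x - (\<tau> + 1))\<^sup>2) (at x)" for x
    by (auto intro!: derivative_eq_intros simp: algebra_simps power2_eq_square)
  ultimately show "has_bochner_integral M (\<lambda>\<omega>. of_bool (\<tau> < X \<omega>) * (X \<omega> - (\<tau> + 1))\<^sup>2) (exp (- \<tau>))"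
    using exponential_tail_integral[OF D, of "\<lambda>x. (x - (\<tau> + 1))\<^sup>2" \<tau> "\<lambda>x. - exp (- x) * ((x - \<tau>)\<^sup>2 + 1)"] \<tau>
    by simp
qed

end

text \<open>A single receiver, with \<open>H\<close> its direct gain and \<open>I\<close> its
  interference. The rate bounds are proved here from independence and moments of \<open>I\<close>,
  without its structure as a sum.\<close>

locale exponential_signal = prob_space M for M :: "'a measure" +
  fixes H I :: "'a \<Rightarrow> real"
  assumes signal_exponential: "distributed M lborel H (exponential_density 1)"
    and signal_indep: "indep_var borel H borel I"
    and I_nonneg: "AE \<omega> in M. 0 \<le> I \<omega>"
    and I_integrable: "integrable M I"
begin

lemma H_measurable [measurable]: "H \<in> borel_measurable M"
  using distributed_measurable[OF signal_exponential] by simp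

lemma I_measurable [measurable]: "I \<in> borel_measurable M"
  using I_integrable by simp

text \<open>By independence, expectations factor for each summand of the pointwise bounds.\<close>

lemma tail_product:
  fixes f g :: "real \<Rightarrow> real"
  assumes [measurable]: "f \<in> borel_measurable borel" "g \<in> borel_measurable borel"
    and g: "has_bochner_integral M (\<lambda>\<omega>. of_bool (\<tau> < H \<omega>) * g (H \<omega>)) c"
    and f: "has_bochner_integral M (\<lambda>\<omega>. f (I \<omega>)) e"
  shows "has_bochner_integral M (\<lambda>\<omega>. of_bool (\<tau> < H \<omega>) * g (H \<omega>) * f (I \<omega>)) (c * e)"
proof -
  have "indep_var borel ((\<lambda>x. of_bool (\<tau> < x) * g x) \<circ> H) borel (f \<circ> I)"
    by (rule indep_var_compose[OF signal_indep]) simp_all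
  then have ind: "indep_var borel (\<lambda>\<omega>. of_bool (\<tau> < H \<omega>) * g (H \<omega>)) borel (\<lambda>\<omega>. f (I \<omega>))"
    by (simp add: comp_def)
  show ?thesis
    using indep_var_integrable[OF ind] indep_var_lebesgue_integral[OF ind] f g
    by (simp add: has_bochner_integral_iff)
qed

lemma tail_linear:
  assumes "0 \<le> \<tau>"
  shows "has_bochner_integral M (\<lambda>\<omega>. of_bool (\<tau> < H \<omega>) * (c + (H \<omega> - (\<tau> + 1)) / w)) (exp (- \<tau>) * c)"
proof -
  have "has_bochner_integral M (\<lambda>\<omega>. (c - (\<tau> + 1) / w) * of_bool (\<tau> < H \<omega>)
      + (1 / w) * (of_bool (\<tau> < H \<omega>) * H \<omega>))
      ((c - (\<tau> + 1) / w) * exp (- \<tau>) + (1 / w) * (exp (- \<tau>) * (\<tau> + 1)))"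
    using exponential_tail_moments[OF signal_exponential assms]
    by (intro has_bochner_integral_add has_bochner_integral_mult_right) auto
  also have "(\<lambda>\<omega>. (c - (\<tau> + 1) / w) * of_bool (\<tau> < H \<omega>) + (1 / w) * (of_bool (\<tau> < H \<omega>) * H \<omega>))
      = (\<lambda>\<omega>. of_bool (\<tau> < H \<omega>) * (c + (H \<omega> - (\<tau> + 1)) / w))"
    by (intro ext) (simp add: algebra_simps add_divide_distrib diff_divide_distrib)
  also have "(c - (\<tau> + 1) / w) * exp (- \<tau>) + (1 / w) * (exp (- \<tau>) * (\<tau> + 1)) = exp (- \<tau>) * c"
    by (simp add: algebra_simps add_divide_distrib)
  finally show ?thesis .
qed

lemma tail_saturation:
  assumes "0 \<le> \<tau>" "0 < m"
  shows "integrable M (\<lambda>\<omega>. of_bool (\<tau> < H \<omega>) * (H \<omega> / (m + H \<omega>)))"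
  by (rule integrable_const_bound[where B = 1]) (use assms in auto)

lemma prob_I_integral: "has_bochner_integral M (\<lambda>\<omega>. of_bool (I \<omega> < x) :: real) (prob {\<omega> \<in> space M. I \<omega> < x})"
proof -
  have "has_bochner_integral M (indicator {\<omega> \<in> space M. I \<omega> < x} :: 'a \<Rightarrow> real) (prob {\<omega> \<in> space M. I \<omega> < x})"
    by (intro has_bochner_integral_real_indicator) (auto simp: emeasure_eq_measure)
  then show ?thesis
    by (subst has_bochner_integral_cong[OF refl _ refl, where g = "indicator {\<omega> \<in> space M. I \<omega> < x}"])
      (auto simp: indicator_def)
qed

lemma rate_integrable:
  assumes "0 \<le> \<tau>" "0 < s"
  shows "integrable M (\<lambda>\<omega>. of_bool (\<tau> < H \<omega>) * ln (1 + H \<omega> / (I \<omega> + s)))"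
proof (rule Bochner_Integration.integrable_bound)
  show "integrable M (\<lambda>\<omega>. (of_bool (\<tau> < H \<omega>) * H \<omega>) / s)"
    using exponential_tail_moments(2)[OF signal_exponential assms(1)]
    by (auto simp: has_bochner_integral_iff)
  show "AE \<omega> in M. norm (of_bool (\<tau> < H \<omega>) * ln (1 + H \<omega> / (I \<omega> + s)))
      \<le> norm (of_bool (\<tau> < H \<omega>) * H \<omega> / s)"
    using I_nonneg
  proof eventually_elim
    case (elim \<omega>)
    show ?case
    proof (cases "\<tau> < H \<omega>")
      case True
      then have h: "0 < H \<omega>"
        using assms by simp
      have "ln (1 + H \<omega> / (I \<omega> + s)) \<le> H \<omega> / (I \<omega> + s)"
        using h elim assms by (intro ln_add_one_self_le_self) auto
      also have "\<dots> \<le> H \<omega> / s"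
        using h elim assms by (intro divide_left_mono) auto
      finally show ?thesis
        using h elim assms True by simp
    qed simp
  qed
qed simp

text \<open>Integration of \<open>ln_one_plus_div_le_concentrated\<close> with
  \<open>a = \<tau> + 1\<close>: the terms linear in the signal or in the interference average out,
  leaving a variance term and a lower tail probability.\<close>

lemma rate_expectation_le_concentrated:
  assumes \<tau>: "0 \<le> \<tau>" and s: "0 < s" and m: "expectation I = m" "0 < m"
    and var: "integrable M (\<lambda>\<omega>. (m - I \<omega>)\<^sup>2)" "expectation (\<lambda>\<omega>. (m - I \<omega>)\<^sup>2) \<le> v"
    and \<theta>: "0 < \<theta>" "\<theta> \<le> 1"
  shows "expectation (\<lambda>\<omega>. of_bool (\<tau> < H \<omega>) * ln (1 + H \<omega> / (I \<omega> + s)))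
    \<le> exp (- \<tau>) * (ln (1 + (\<tau> + 1) / m) + (\<tau> + 1) * v / (\<theta> * m ^ 3)
        + prob {\<omega> \<in> space M. I \<omega> < \<theta> * m} * ln (1 + (\<tau> + 1) / s))"
proof -
  define T where "T \<omega> = (of_bool (\<tau> < H \<omega>) :: real)" for \<omega>
  define p where "p = prob {\<omega> \<in> space M. I \<omega> < \<theta> * m}"
  \<comment> \<open>\<open>S\<close> need not be computed: it gets multiplied by the mean of
    \<open>(m - I) / m\<close>, which is zero.\<close>
  define S where "S = expectation (\<lambda>\<omega>. T \<omega> * (H \<omega> / (m + H \<omega>)))"
  have b1: "has_bochner_integral M (\<lambda>\<omega>. T \<omega> * (ln (1 + (\<tau> + 1) / m) + (H \<omega> - (\<tau> + 1)) / (m + (\<tau> + 1))))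
      (exp (- \<tau>) * ln (1 + (\<tau> + 1) / m))"
    unfolding T_def by (rule tail_linear[OF \<tau>])
  have b2: "has_bochner_integral M (\<lambda>\<omega>. T \<omega> * (H \<omega> / (m + H \<omega>)) * ((m - I \<omega>) / m)) (S * 0)"
    unfolding T_def
  proof (rule tail_product[where f = "\<lambda>x. (m - x) / m" and g = "\<lambda>x. x / (m + x)"])
    show "has_bochner_integral M (\<lambda>\<omega>. of_bool (\<tau> < H \<omega>) * (H \<omega> / (m + H \<omega>))) S"
      using tail_saturation[OF \<tau> m(2)] by (simp add: has_bochner_integral_iff S_def T_def)
    show "has_bochner_integral M (\<lambda>\<omega>. (m - I \<omega>) / m) 0"
      using I_integrable m by (simp add: has_bochner_integral_iff prob_space)
  qed simp_all
  have b3: "has_bochner_integral M (\<lambda>\<omega>. T \<omega> * H \<omega> * ((m - I \<omega>)\<^sup>2 / (\<theta> * m ^ 3)))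
      (exp (- \<tau>) * (\<tau> + 1) * (expectation (\<lambda>\<omega>. (m - I \<omega>)\<^sup>2) / (\<theta> * m ^ 3)))"
    unfolding T_def
    by (rule tail_product[where f = "\<lambda>x. (m - x)\<^sup>2 / (\<theta> * m ^ 3)" and g = "\<lambda>x. x"])
      (use exponential_tail_moments(2)[OF signal_exponential \<tau>] var in \<open>simp_all add: has_bochner_integral_iff\<close>)
  have b4: "has_bochner_integral M (\<lambda>\<omega>. T \<omega> * (ln (1 + (\<tau> + 1) / s) + (H \<omega> - (\<tau> + 1)) / (s + (\<tau> + 1)))
      * of_bool (I \<omega> < \<theta> * m)) (exp (- \<tau>) * ln (1 + (\<tau> + 1) / s) * p)"
    unfolding T_def p_def
    by (rule tail_product[where f = "\<lambda>x. of_bool (x < \<theta> * m)"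
          and g = "\<lambda>x. ln (1 + (\<tau> + 1) / s) + (x - (\<tau> + 1)) / (s + (\<tau> + 1))"])
      (simp_all add: tail_linear[OF \<tau>] prob_I_integral)
  note b = has_bochner_integral_add[OF has_bochner_integral_add[OF has_bochner_integral_add[OF b1 b2] b3] b4]
  have "expectation (\<lambda>\<omega>. T \<omega> * ln (1 + H \<omega> / (I \<omega> + s)))
    \<le> exp (- \<tau>) * ln (1 + (\<tau> + 1) / m) + S * 0
      + exp (- \<tau>) * (\<tau> + 1) * (expectation (\<lambda>\<omega>. (m - I \<omega>)\<^sup>2) / (\<theta> * m ^ 3))
      + exp (- \<tau>) * ln (1 + (\<tau> + 1) / s) * p"
    unfolding has_bochner_integral_integral_eq[OF b, symmetric]
  proof (rule integral_mono_AE)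
    show "integrable M (\<lambda>\<omega>. T \<omega> * ln (1 + H \<omega> / (I \<omega> + s)))"
      unfolding T_def by (rule rate_integrable[OF \<tau> s])
    show "AE \<omega> in M. T \<omega> * ln (1 + H \<omega> / (I \<omega> + s))
      \<le> T \<omega> * (ln (1 + (\<tau> + 1) / m) + (H \<omega> - (\<tau> + 1)) / (m + (\<tau> + 1)))
        + T \<omega> * (H \<omega> / (m + H \<omega>)) * ((m - I \<omega>) / m) + T \<omega> * H \<omega> * ((m - I \<omega>)\<^sup>2 / (\<theta> * m ^ 3))
        + T \<omega> * (ln (1 + (\<tau> + 1) / s) + (H \<omega> - (\<tau> + 1)) / (s + (\<tau> + 1))) * of_bool (I \<omega> < \<theta> * m)"
      using I_nonneg
    proof eventually_elim
      case (elim \<omega>)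
      then show ?case
        using ln_one_plus_div_le_concentrated[of "H \<omega>" "\<tau> + 1" m \<theta> s "I \<omega>"] \<tau> s m \<theta>
        by (cases "\<tau> < H \<omega>") (auto simp: T_def mult.commute)
    qed
  qed (use b in \<open>auto simp: has_bochner_integral_iff\<close>)
  also have "exp (- \<tau>) * (\<tau> + 1) * (expectation (\<lambda>\<omega>. (m - I \<omega>)\<^sup>2) / (\<theta> * m ^ 3))
      \<le> exp (- \<tau>) * (\<tau> + 1) * (v / (\<theta> * m ^ 3))"
    using \<tau> \<theta> m var by (intro mult_left_mono divide_right_mono) auto
  finally show ?thesis
    by (simp add: T_def p_def algebra_simps)
qed

lemma rate_expectation_le_split:
  assumes \<tau>: "0 \<le> \<tau>" and s: "0 < s" and \<eta>: "0 < \<eta>"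
  shows "expectation (\<lambda>\<omega>. of_bool (\<tau> < H \<omega>) * ln (1 + H \<omega> / (I \<omega> + s)))
    \<le> exp (- \<tau>) * (prob {\<omega> \<in> space M. I \<omega> < \<eta>} * ln (1 + (\<tau> + 1) / s) + ln (1 + (\<tau> + 1) / \<eta>))"
proof -
  define T where "T \<omega> = (of_bool (\<tau> < H \<omega>) :: real)" for \<omega>
  have b1: "has_bochner_integral M (\<lambda>\<omega>. T \<omega> * (ln (1 + (\<tau> + 1) / s) + (H \<omega> - (\<tau> + 1)) / (s + (\<tau> + 1)))
      * of_bool (I \<omega> < \<eta>)) (exp (- \<tau>) * ln (1 + (\<tau> + 1) / s) * prob {\<omega> \<in> space M. I \<omega> < \<eta>})"
    unfolding T_def
    by (rule tail_product[where f = "\<lambda>x. of_bool (x < \<eta>)"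
          and g = "\<lambda>x. ln (1 + (\<tau> + 1) / s) + (x - (\<tau> + 1)) / (s + (\<tau> + 1))"])
      (simp_all add: tail_linear[OF \<tau>] prob_I_integral)
  have b2: "has_bochner_integral M (\<lambda>\<omega>. T \<omega> * (ln (1 + (\<tau> + 1) / \<eta>) + (H \<omega> - (\<tau> + 1)) / (\<eta> + (\<tau> + 1))))
      (exp (- \<tau>) * ln (1 + (\<tau> + 1) / \<eta>))"
    unfolding T_def by (rule tail_linear[OF \<tau>])
  note b = has_bochner_integral_add[OF b1 b2]
  have "expectation (\<lambda>\<omega>. T \<omega> * ln (1 + H \<omega> / (I \<omega> + s)))
    \<le> exp (- \<tau>) * ln (1 + (\<tau> + 1) / s) * prob {\<omega> \<in> space M. I \<omega> < \<eta>} + exp (- \<tau>) * ln (1 + (\<tau> + 1) / \<eta>)"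
    unfolding has_bochner_integral_integral_eq[OF b, symmetric]
  proof (rule integral_mono_AE)
    show "integrable M (\<lambda>\<omega>. T \<omega> * ln (1 + H \<omega> / (I \<omega> + s)))"
      unfolding T_def by (rule rate_integrable[OF \<tau> s])
    show "AE \<omega> in M. T \<omega> * ln (1 + H \<omega> / (I \<omega> + s))
      \<le> T \<omega> * (ln (1 + (\<tau> + 1) / s) + (H \<omega> - (\<tau> + 1)) / (s + (\<tau> + 1))) * of_bool (I \<omega> < \<eta>)
        + T \<omega> * (ln (1 + (\<tau> + 1) / \<eta>) + (H \<omega> - (\<tau> + 1)) / (\<eta> + (\<tau> + 1)))"
      using I_nonneg
    proof eventually_elim
      case (elim \<omega>)
      then show ?case
        using ln_one_plus_div_le_split[of "H \<omega>" "\<tau> + 1" \<eta> s "I \<omega>"] \<tau> s \<eta>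
        by (cases "\<tau> < H \<omega>") (auto simp: T_def mult.commute)
    qed
  qed (use b in \<open>auto simp: has_bochner_integral_iff\<close>)
  then show ?thesis
    by (simp add: T_def algebra_simps)
qed

text \<open>Integration of \<open>ln_one_plus_div_ge\<close>. The interference term has a
  nonnegative mean because \<open>B\<close> is at least noise plus mean interference, and the
  quadratic term contributes the conditional variance 1 of the signal.\<close>

lemma rate_expectation_ge:
  assumes \<tau>: "0 \<le> \<tau>" and b: "0 < b" and B: "expectation I + b \<le> B" "2 \<le> B + (\<tau> + 1)"
  shows "exp (- \<tau>) * (ln (1 + (\<tau> + 1) / B) - 2 / (B + (\<tau> + 1))\<^sup>2)
    \<le> expectation (\<lambda>\<omega>. of_bool (\<tau> < H \<omega>) * ln (1 + H \<omega> / (I \<omega> + b)))"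
proof -
  have "0 \<le> expectation I"
    using I_nonneg by (rule integral_nonneg_AE)
  then have B0: "0 < B"
    using b B(1) by linarith
  define T where "T \<omega> = (of_bool (\<tau> < H \<omega>) :: real)" for \<omega>
  define S where "S = expectation (\<lambda>\<omega>. T \<omega> * (H \<omega> / (B + H \<omega>)))"
  have "0 \<le> S"
    unfolding S_def T_def using \<tau> B0 by (intro Bochner_Integration.integral_nonneg) auto
  have b1: "has_bochner_integral M (\<lambda>\<omega>. T \<omega> * (ln (1 + (\<tau> + 1) / B) + (H \<omega> - (\<tau> + 1)) / (B + (\<tau> + 1))))
      (exp (- \<tau>) * ln (1 + (\<tau> + 1) / B))"
    unfolding T_def by (rule tail_linear[OF \<tau>])
  have b2: "has_bochner_integral M (\<lambda>\<omega>. 2 / (B + (\<tau> + 1))\<^sup>2 * (T \<omega> * (H \<omega> - (\<tau> + 1))\<^sup>2))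
      (2 / (B + (\<tau> + 1))\<^sup>2 * exp (- \<tau>))"
    unfolding T_def by (intro has_bochner_integral_mult_right
        exponential_tail_moments(3)[OF signal_exponential \<tau>])
  have b3: "has_bochner_integral M (\<lambda>\<omega>. T \<omega> * (H \<omega> / (B + H \<omega>)) * ((B - b - I \<omega>) / B))
      (S * ((B - b - expectation I) / B))"
    unfolding T_def
  proof (rule tail_product[where f = "\<lambda>x. (B - b - x) / B" and g = "\<lambda>x. x / (B + x)"])
    show "has_bochner_integral M (\<lambda>\<omega>. of_bool (\<tau> < H \<omega>) * (H \<omega> / (B + H \<omega>))) S"
      using tail_saturation[OF \<tau> B0] by (simp add: has_bochner_integral_iff S_def T_def)
    show "has_bochner_integral M (\<lambda>\<omega>. (B - b - I \<omega>) / B) ((B - b - expectation I) / B)"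
      using I_integrable by (simp add: has_bochner_integral_iff prob_space)
  qed simp_all
  note bb = has_bochner_integral_add[OF has_bochner_integral_diff[OF b1 b2] b3]
  have "exp (- \<tau>) * ln (1 + (\<tau> + 1) / B) - 2 / (B + (\<tau> + 1))\<^sup>2 * exp (- \<tau>)
      + S * ((B - b - expectation I) / B)
    \<le> expectation (\<lambda>\<omega>. T \<omega> * ln (1 + H \<omega> / (I \<omega> + b)))"
    unfolding has_bochner_integral_integral_eq[OF bb, symmetric]
  proof (rule integral_mono_AE)
    show "integrable M (\<lambda>\<omega>. T \<omega> * ln (1 + H \<omega> / (I \<omega> + b)))"
      unfolding T_def by (rule rate_integrable[OF \<tau> b])
    show "AE \<omega> in M. T \<omega> * (ln (1 + (\<tau> + 1) / B) + (H \<omega> - (\<tau> + 1)) / (B + (\<tau> + 1)))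
        - 2 / (B + (\<tau> + 1))\<^sup>2 * (T \<omega> * (H \<omega> - (\<tau> + 1))\<^sup>2)
        + T \<omega> * (H \<omega> / (B + H \<omega>)) * ((B - b - I \<omega>) / B)
      \<le> T \<omega> * ln (1 + H \<omega> / (I \<omega> + b))"
      using I_nonneg
    proof eventually_elim
      case (elim \<omega>)
      then show ?case
        using ln_one_plus_div_ge[of "\<tau> + 1" B "H \<omega>" b "I \<omega>"] \<tau> b B B0
        by (cases "\<tau> < H \<omega>") (auto simp: T_def)
    qed
  qed (use bb in \<open>auto simp: has_bochner_integral_iff\<close>)
  moreover have "0 \<le> S * ((B - b - expectation I) / B)"
    using \<open>0 \<le> S\<close> B(1) B0 by simp
  ultimately show ?thesis
    by (simp add: T_def algebra_simps)
qed

end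

section \<open>Variance of independent sums, lower tail bounds and Laplace transforms\<close>

context prob_space begin

text \<open>Induction on the index set: the cross term of independent centred variables vanishes,
  and each variance is at most the second moment.\<close>

lemma expectation_square_sum_centered_le:
  fixes X :: "'i \<Rightarrow> 'a \<Rightarrow> real"
  assumes "finite J" and "indep_vars (\<lambda>_. borel) X J"
    and "\<And>k. k \<in> J \<Longrightarrow> integrable M (X k)" "\<And>k. k \<in> J \<Longrightarrow> integrable M (\<lambda>\<omega>. (X k \<omega>)\<^sup>2)"
  shows "integrable M (\<lambda>\<omega>. ((\<Sum>k\<in>J. expectation (X k)) - (\<Sum>k\<in>J. X k \<omega>))\<^sup>2) \<and>
    expectation (\<lambda>\<omega>. ((\<Sum>k\<in>J. expectation (X k)) - (\<Sum>k\<in>J. X k \<omega>))\<^sup>2)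
      \<le> (\<Sum>k\<in>J. expectation (\<lambda>\<omega>. (X k \<omega>)\<^sup>2))"
  using assms
proof (induction J rule: finite_induct)
  case empty
  then show ?case by simp
next
  case (insert i J)
  define Z where "Z \<omega> = expectation (X i) - X i \<omega>" for \<omega>
  define V where "V \<omega> = (\<Sum>k\<in>J. expectation (X k)) - (\<Sum>k\<in>J. X k \<omega>)" for \<omega>
  have IH: "integrable M (\<lambda>\<omega>. (V \<omega>)\<^sup>2)"
    "expectation (\<lambda>\<omega>. (V \<omega>)\<^sup>2) \<le> (\<Sum>k\<in>J. expectation (\<lambda>\<omega>. (X k \<omega>)\<^sup>2))"
    using insert.IH[OF indep_vars_subset[OF insert.prems(1)]] insert.prems by (auto simp: V_def)
  have int: "integrable M (X i)" "integrable M (\<lambda>\<omega>. (X i \<omega>)\<^sup>2)" "\<And>k. k \<in> J \<Longrightarrow> integrable M (X k)"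
    using insert.prems by auto
  have Z: "integrable M Z" "expectation Z = 0"
    using int by (auto simp: Z_def[abs_def] prob_space)
  have V: "integrable M V" "expectation V = 0"
    using int by (auto simp: V_def[abs_def] prob_space)
  have Z2: "has_bochner_integral M (\<lambda>\<omega>. (Z \<omega>)\<^sup>2) (expectation (\<lambda>\<omega>. (X i \<omega>)\<^sup>2) - (expectation (X i))\<^sup>2)"
  proof -
    have "has_bochner_integral M (\<lambda>\<omega>. (X i \<omega>)\<^sup>2 - 2 * expectation (X i) * X i \<omega> + (expectation (X i))\<^sup>2)
        (expectation (\<lambda>\<omega>. (X i \<omega>)\<^sup>2) - 2 * expectation (X i) * expectation (X i) + (expectation (X i))\<^sup>2)"
      using int by (simp add: has_bochner_integral_iff prob_space)
    then show ?thesis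
      by (simp add: Z_def power2_eq_square algebra_simps)
  qed
  have "indep_var borel ((\<lambda>x. expectation (X i) - x) \<circ> X i)
      borel ((\<lambda>x. (\<Sum>k\<in>J. expectation (X k)) - x) \<circ> (\<lambda>\<omega>. \<Sum>k\<in>J. X k \<omega>))"
    using indep_vars_sum[OF insert.hyps insert.prems(1)] by (rule indep_var_compose) simp_all
  then have ind: "indep_var borel Z borel V"
    by (simp add: comp_def Z_def[abs_def] V_def[abs_def])
  have ZV: "has_bochner_integral M (\<lambda>\<omega>. Z \<omega> * V \<omega>) 0"
    using indep_var_integrable[OF ind Z(1) V(1)] indep_var_lebesgue_integral[OF ind Z(1) V(1)] Z V
    by (simp add: has_bochner_integral_iff)
  have V2: "has_bochner_integral M (\<lambda>\<omega>. (V \<omega>)\<^sup>2) (expectation (\<lambda>\<omega>. (V \<omega>)\<^sup>2))"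
    using IH by (simp add: has_bochner_integral_iff)
  have "has_bochner_integral M (\<lambda>\<omega>. (Z \<omega>)\<^sup>2 + (V \<omega>)\<^sup>2 + 2 * (Z \<omega> * V \<omega>))
      (expectation (\<lambda>\<omega>. (X i \<omega>)\<^sup>2) - (expectation (X i))\<^sup>2 + expectation (\<lambda>\<omega>. (V \<omega>)\<^sup>2) + 2 * 0)"
    by (intro has_bochner_integral_add Z2 V2 has_bochner_integral_mult_right ZV)
  also have "(\<lambda>\<omega>. (Z \<omega>)\<^sup>2 + (V \<omega>)\<^sup>2 + 2 * (Z \<omega> * V \<omega>))
      = (\<lambda>\<omega>. ((\<Sum>k\<in>insert i J. expectation (X k)) - (\<Sum>k\<in>insert i J. X k \<omega>))\<^sup>2)"
    using insert.hyps by (intro ext) (simp add: Z_def V_def power2_eq_square algebra_simps)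
  finally show ?case
    using diff_mono[OF IH(2) zero_le_power2[of "expectation (X i)"]] insert.hyps
    by (simp add: has_bochner_integral_iff)
qed

text \<open>Chernoff's bound for the lower tail: the indicator of \<open>I < x\<close> is at most
  \<open>exp (z * (x - I))\<close>.\<close>

lemma prob_less_le_exp_moment:
  fixes I :: "'a \<Rightarrow> real"
  assumes [measurable]: "I \<in> borel_measurable M" and "0 \<le> z"
    and int: "integrable M (\<lambda>\<omega>. exp (- z * I \<omega>))"
  shows "prob {\<omega> \<in> space M. I \<omega> < x} \<le> exp (z * x) * expectation (\<lambda>\<omega>. exp (- z * I \<omega>))"
proof -
  have "prob {\<omega> \<in> space M. I \<omega> < x} = expectation (indicator {\<omega> \<in> space M. I \<omega> < x})"
    by simp
  also have "\<dots> \<le> expectation (\<lambda>\<omega>. exp (z * x) * exp (- z * I \<omega>))"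
  proof (rule integral_mono)
    fix \<omega> assume "\<omega> \<in> space M"
    show "indicator {\<omega> \<in> space M. I \<omega> < x} \<omega> \<le> exp (z * x) * exp (- z * I \<omega>)"
      using \<open>0 \<le> z\<close> mult_left_mono[of "I \<omega>" x z]
      by (auto simp: indicator_def exp_add[symmetric])
  qed (use int in \<open>auto simp: integrable_indicator_iff emeasure_eq_measure\<close>)
  also have "\<dots> = exp (z * x) * expectation (\<lambda>\<omega>. exp (- z * I \<omega>))"
    by simp
  finally show ?thesis .
qed

lemma exponential_AE_pos:
  assumes D: "distributed M lborel X (exponential_density 1)"
  shows "AE \<omega> in M. 0 < X \<omega>"
proof -
  have [measurable]: "X \<in> borel_measurable M"
    using distributed_measurable[OF D] by simp
  have "prob {\<omega> \<in> space M. 0 < X \<omega>} = 1"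
    using exponential_distributedD_gt[OF D, of 0] by simp
  then show ?thesis
    by (subst (asm) prob_Collect_eq_1) auto
qed

lemma exponential_laplace:
  assumes D: "distributed M lborel X (exponential_density 1)" and z: "0 \<le> z"
  shows "has_bochner_integral M (\<lambda>\<omega>. exp (- z * X \<omega>)) (1 / (1 + z))"
proof -
  have [measurable]: "X \<in> borel_measurable M"
    using distributed_measurable[OF D] by simp
  have "((\<lambda>x. - exp (- (1 + z) * x) / (1 + z)) \<longlongrightarrow> 0) at_top"
    using z by real_asymp
  moreover have "((\<lambda>x. - exp (- (1 + z) * x) / (1 + z)) has_real_derivative
      exp (- x) * exp (- z * x)) (at x)" for x
  proof -
    have "exp (- x) * exp (- z * x) = exp (- (1 + z) * x)"
      by (simp add: exp_add[symmetric] algebra_simps)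
    then show ?thesis
      using z by (auto intro!: derivative_eq_intros) (simp add: field_simps)
  qed
  ultimately have "has_bochner_integral M (\<lambda>\<omega>. of_bool (0 < X \<omega>) * exp (- z * X \<omega>)) (1 / (1 + z))"
    using exponential_tail_integral[OF D, of "\<lambda>x. exp (- z * x)" 0 "\<lambda>x. - exp (- (1 + z) * x) / (1 + z)"]
    by simp
  then show ?thesis
    by (subst has_bochner_integral_cong_AE[where g = "\<lambda>\<omega>. of_bool (0 < X \<omega>) * exp (- z * X \<omega>)"])
      (use exponential_AE_pos[OF D] in auto)
qed

end

subsection \<open>Interference in the random network\<close>

context random_network begin

lemma h_measurable [measurable]: "h k i \<in> borel_measurable P"
  using distributed_measurable[OF h_exponential] by simp

text \<open>The exponential law is the Erlang law with shape parameter 0, whose moments are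
  known.\<close>

lemma h_moments:
  "has_bochner_integral P (h k i) 1" "has_bochner_integral P (\<lambda>\<omega>. (h k i \<omega>)\<^sup>2) 2"
  using has_bochner_integral_erlang_ith_moment[of 1 "h k i" 0 1]
    has_bochner_integral_erlang_ith_moment[of 1 "h k i" 0 2] h_exponential[of k i]
  by (simp_all add: numeral_2_eq_2)

lemma link_measurable': "k \<noteq> i \<Longrightarrow> (\<lambda>\<omega>. of_bool (\<xi> k i \<omega>) :: real) \<in> borel_measurable P"
  using link_measurable[of k i] by measurable

lemma link_present: "k \<noteq> i \<Longrightarrow> has_bochner_integral P (\<lambda>\<omega>. of_bool (\<xi> k i \<omega>)) \<alpha>"
proof -
  assume ki: "k \<noteq> i"
  have [measurable]: "\<xi> k i \<in> measurable P (count_space UNIV)"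
    using link_measurable[OF ki] .
  have "has_bochner_integral P (indicator {\<omega> \<in> space P. \<xi> k i \<omega>} :: 'a \<Rightarrow> real) \<alpha>"
    unfolding link_prob[OF ki, symmetric]
    by (intro has_bochner_integral_real_indicator) (auto simp: emeasure_eq_measure)
  then show ?thesis
    by (subst has_bochner_integral_cong[OF refl _ refl, where g = "indicator {\<omega> \<in> space P. \<xi> k i \<omega>}"])
      (auto simp: indicator_def)
qed

lemma gain_cross: "k \<noteq> i \<Longrightarrow> gain h \<beta> \<xi> k i \<omega> = of_bool (\<xi> k i \<omega>) * \<beta> k i \<omega> * h k i \<omega>"
  by (simp add: gain_def)

lemma gain_measurable [measurable]: "gain h \<beta> \<xi> k i \<in> borel_measurable P"
proof (cases "k = i")
  case True
  then have "gain h \<beta> \<xi> k i = h i i"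
    by (auto simp: gain_def)
  then show ?thesis by simp
next
  case False
  then have "gain h \<beta> \<xi> k i = (\<lambda>\<omega>. of_bool (\<xi> k i \<omega>) * \<beta> k i \<omega> * h k i \<omega>)"
    by (auto simp: gain_cross)
  then show ?thesis
    using link_measurable'[OF False] beta_measurable[OF False] by simp
qed

text \<open>The three factors are independent; \<open>X\<close> and \<open>Y\<close> list them and
  their transformations by position, to match the indexing of
  \<open>within_link_independent\<close>.\<close>

lemma link_product:
  fixes f g :: "real \<Rightarrow> real"
  assumes ki: "k \<noteq> i" and [measurable]: "f \<in> borel_measurable borel" "g \<in> borel_measurable borel"
    and f: "has_bochner_integral P (\<lambda>\<omega>. f (\<beta> k i \<omega>)) c"
    and g: "has_bochner_integral P (\<lambda>\<omega>. g (h k i \<omega>)) e"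
  shows "has_bochner_integral P (\<lambda>\<omega>. of_bool (\<xi> k i \<omega>) * f (\<beta> k i \<omega>) * g (h k i \<omega>)) (\<alpha> * c * e)"
proof -
  define X where "X m = [\<lambda>\<omega>. of_bool (\<xi> k i \<omega>), \<beta> k i, h k i] ! m" for m :: nat
  define Y where "Y m = [\<lambda>x. x, f, g] ! m" for m :: nat
  have Ym: "Y m \<in> borel_measurable borel" if "m \<in> {..<3}" for m
    using that by (auto simp: Y_def less_Suc_eq eval_nat_numeral)
  have ind: "indep_vars (\<lambda>_. borel) (\<lambda>m \<omega>. Y m (X m \<omega>)) {..<3}"
    using within_link_independent[OF ki] Ym unfolding X_def[symmetric] by (rule indep_vars_compose2)
  have int: "integrable P (\<lambda>\<omega>. Y m (X m \<omega>))" if "m \<in> {..<3}" for m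
    using that f g link_present[OF ki]
    by (auto simp: Y_def X_def less_Suc_eq eval_nat_numeral has_bochner_integral_iff)
  have "has_bochner_integral P (\<lambda>\<omega>. \<Prod>m<3. Y m (X m \<omega>)) (\<Prod>m<3. \<integral>\<omega>. Y m (X m \<omega>) \<partial>P)"
    using indep_vars_lebesgue_integral[OF _ ind int] indep_vars_integrable[OF _ ind int]
    by (simp add: has_bochner_integral_iff)
  then show ?thesis
    using f g link_present[OF ki]
    by (simp add: Y_def X_def eval_nat_numeral has_bochner_integral_iff)
qed

lemma beta_integral:
  assumes ki: "k \<noteq> i"
  shows "has_bochner_integral P (\<beta> k i) \<mu>"
    and "integrable P (\<lambda>\<omega>. (\<beta> k i \<omega>)\<^sup>2)"
    and "expectation (\<lambda>\<omega>. (\<beta> k i \<omega>)\<^sup>2) \<le> \<beta>max\<^sup>2"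
proof -
  have [measurable]: "\<beta> k i \<in> borel_measurable P"
    using beta_measurable[OF ki] .
  have b: "AE \<omega> in P. norm (\<beta> k i \<omega>) \<le> \<beta>max"
    using beta_bounded[OF ki] by eventually_elim (use beta_min_pos in auto)
  then have "integrable P (\<beta> k i)"
    by (rule integrable_const_bound) simp
  then show "has_bochner_integral P (\<beta> k i) \<mu>"
    using beta_mean[OF ki] by (simp add: has_bochner_integral_iff)
  have b2: "AE \<omega> in P. (\<beta> k i \<omega>)\<^sup>2 \<le> \<beta>max\<^sup>2"
    using beta_bounded[OF ki] by eventually_elim (use beta_min_pos in \<open>auto intro!: power_mono\<close>)
  show int: "integrable P (\<lambda>\<omega>. (\<beta> k i \<omega>)\<^sup>2)"
    by (rule integrable_const_bound[where B = "\<beta>max\<^sup>2"]) (use b2 in auto)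
  show "expectation (\<lambda>\<omega>. (\<beta> k i \<omega>)\<^sup>2) \<le> \<beta>max\<^sup>2"
    using integral_mono_AE[OF int _ b2] by (simp add: prob_space)
qed

lemma beta_range: "\<beta>min \<le> \<mu>" "\<mu> \<le> \<beta>max"
proof -
  have ki: "(0::nat) \<noteq> 1" by simp
  have int: "integrable P (\<beta> 0 1)" "expectation (\<beta> 0 1) = \<mu>"
    using beta_integral(1)[OF ki] by (auto simp: has_bochner_integral_iff)
  have "expectation (\<lambda>_. \<beta>min) \<le> expectation (\<beta> 0 1)"
    using beta_bounded[OF ki] int by (intro integral_mono_AE) auto
  then show "\<beta>min \<le> \<mu>" using int by (simp add: prob_space)
  have "expectation (\<beta> 0 1) \<le> expectation (\<lambda>_. \<beta>max)"
    using beta_bounded[OF ki] int by (intro integral_mono_AE) auto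
  then show "\<mu> \<le> \<beta>max" using int by (simp add: prob_space)
qed

lemma gain_nonneg: "AE \<omega> in P. 0 \<le> gain h \<beta> \<xi> k i \<omega>"
proof (cases "k = i")
  case True
  then show ?thesis
    using exponential_AE_pos[OF h_exponential[of i i]] by (auto simp: gain_def)
next
  case False
  show ?thesis
    using exponential_AE_pos[OF h_exponential[of k i]] beta_bounded[OF False]
    by eventually_elim (use beta_min_pos in \<open>auto simp: gain_def\<close>)
qed

lemma cross_gain_mean:
  assumes "k \<noteq> i"
  shows "has_bochner_integral P (gain h \<beta> \<xi> k i) (\<alpha> * \<mu>)"
  using link_product[OF assms, of "\<lambda>x. x" "\<lambda>x. x" \<mu> 1] beta_integral(1)[OF assms] h_moments(1)[of k i]
  by (simp add: gain_cross[OF assms, abs_def])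

lemma cross_gain_square:
  assumes "k \<noteq> i"
  shows "integrable P (\<lambda>\<omega>. (gain h \<beta> \<xi> k i \<omega>)\<^sup>2)"
    and "expectation (\<lambda>\<omega>. (gain h \<beta> \<xi> k i \<omega>)\<^sup>2) \<le> 2 * \<alpha> * \<beta>max\<^sup>2"
proof -
  have [simp]: "(of_bool b :: real)\<^sup>2 = of_bool b" for b
    by (cases b) auto
  have *: "has_bochner_integral P (\<lambda>\<omega>. (gain h \<beta> \<xi> k i \<omega>)\<^sup>2) (\<alpha> * expectation (\<lambda>\<omega>. (\<beta> k i \<omega>)\<^sup>2) * 2)"
    using link_product[OF assms, of "\<lambda>x. x\<^sup>2" "\<lambda>x. x\<^sup>2"] beta_integral(2)[OF assms] h_moments(2)[of k i]
    by (simp add: gain_cross[OF assms] power_mult_distrib has_bochner_integral_iff)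
  then show "integrable P (\<lambda>\<omega>. (gain h \<beta> \<xi> k i \<omega>)\<^sup>2)"
    by (simp add: has_bochner_integral_iff)
  show "expectation (\<lambda>\<omega>. (gain h \<beta> \<xi> k i \<omega>)\<^sup>2) \<le> 2 * \<alpha> * \<beta>max\<^sup>2"
    using * beta_integral(3)[OF assms] alpha_range mult_left_mono[of _ "\<beta>max\<^sup>2" \<alpha>]
    by (simp add: has_bochner_integral_iff)
qed

lemma exp_gain_integrable:
  assumes "0 \<le> z"
  shows "integrable P (\<lambda>\<omega>. exp (- z * gain h \<beta> \<xi> k i \<omega>))"
proof (rule integrable_const_bound[where B = 1])
  show "AE \<omega> in P. norm (exp (- z * gain h \<beta> \<xi> k i \<omega>)) \<le> 1"
    using gain_nonneg[of k i] by eventually_elim (use assms in auto)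
qed simp

text \<open>Lowering the shadowing to \<open>\<beta>min\<close> can only increase
  \<open>exp (- z * gain)\<close>, and for constant shadowing the transform of the fading is
  \<open>1 / (1 + z * \<beta>min)\<close>.\<close>

lemma cross_gain_laplace:
  assumes ki: "k \<noteq> i" and z: "0 \<le> z"
  shows "expectation (\<lambda>\<omega>. exp (- z * gain h \<beta> \<xi> k i \<omega>)) \<le> 1 - \<alpha> * (z * \<beta>min / (1 + z * \<beta>min))"
proof -
  have zb: "0 \<le> z * \<beta>min"
    using z beta_min_pos by simp
  have "has_bochner_integral P (\<lambda>\<omega>. 1 - exp (- (z * \<beta>min) * h k i \<omega>)) (1 - 1 / (1 + z * \<beta>min))"
    using exponential_laplace[OF h_exponential[of k i] zb]
    by (simp add: has_bochner_integral_iff prob_space)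
  also have "1 - 1 / (1 + z * \<beta>min) = z * \<beta>min / (1 + z * \<beta>min)"
    using zb by (simp add: field_simps)
  finally have "has_bochner_integral P (\<lambda>\<omega>. of_bool (\<xi> k i \<omega>) * 1 * (1 - exp (- (z * \<beta>min) * h k i \<omega>)))
      (\<alpha> * 1 * (z * \<beta>min / (1 + z * \<beta>min)))"
    by (intro link_product[OF ki, of "\<lambda>_. 1" "\<lambda>x. 1 - exp (- (z * \<beta>min) * x)"])
      (simp_all add: has_bochner_integral_iff prob_space)
  then have *: "has_bochner_integral P (\<lambda>\<omega>. 1 - of_bool (\<xi> k i \<omega>) * (1 - exp (- (z * \<beta>min) * h k i \<omega>)))
      (1 - \<alpha> * (z * \<beta>min / (1 + z * \<beta>min)))"
    by (simp add: has_bochner_integral_iff prob_space)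
  show ?thesis
    unfolding has_bochner_integral_integral_eq[OF *, symmetric]
  proof (rule integral_mono_AE)
    show "AE \<omega> in P. exp (- z * gain h \<beta> \<xi> k i \<omega>)
        \<le> 1 - of_bool (\<xi> k i \<omega>) * (1 - exp (- (z * \<beta>min) * h k i \<omega>))"
      using exponential_AE_pos[OF h_exponential[of k i]] beta_bounded[OF ki]
    proof eventually_elim
      case (elim \<omega>)
      then have "z * (\<beta>min * h k i \<omega>) \<le> z * (\<beta> k i \<omega> * h k i \<omega>)"
        using z by (intro mult_left_mono mult_right_mono) auto
      then show ?case
        using ki by (simp add: gain_def mult.assoc)
    qed
  qed (use * exp_gain_integrable[OF z] in \<open>auto simp: has_bochner_integral_iff\<close>)
qed

section \<open>Contributions of single interferers and their sum\<close>

abbreviation (input) "L \<equiv> gain h \<beta> \<xi>"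

lemma gain_self: "L i i = h i i"
  by (auto simp: gain_def)

lemma on_off_power_measurable [measurable]: "on_off_power L \<tau> i \<in> borel_measurable P"
  unfolding on_off_power_def[abs_def] by measurable

lemma on_off_power_integral:
  assumes "0 \<le> \<tau>"
  shows "has_bochner_integral P (on_off_power L \<tau> k) (exp (- \<tau>))"
  using exponential_tail_moments(1)[OF h_exponential[of k k] assms]
  by (simp add: on_off_power_def[abs_def] gain_self of_bool_def)

text \<open>The cross gain is entry \<open>(k, i)\<close> of the array and the power depends on
  entry \<open>(k, k)\<close>. For \<open>k \<noteq> i\<close> these are distinct, hence
  independent.\<close>

lemma gain_power_product:
  fixes f :: "real \<Rightarrow> real"
  assumes "k \<noteq> i" "0 \<le> \<tau>" and [measurable]: "f \<in> borel_measurable borel"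
    and f: "has_bochner_integral P (\<lambda>\<omega>. f (L k i \<omega>)) c"
  shows "has_bochner_integral P (\<lambda>\<omega>. f (L k i \<omega>) * on_off_power L \<tau> k \<omega>) (c * exp (- \<tau>))"
proof -
  define Y where "Y p = (if p = (k, i) then f else (\<lambda>x. if x > \<tau> then 1 else 0))" for p :: "nat \<times> nat"
  define X where "X = (\<lambda>(k, i). L k i)"
  have ind: "indep_vars (\<lambda>_. borel) (\<lambda>p \<omega>. Y p (X p \<omega>)) {(k, i), (k, k)}"
    using indep_vars_subset[OF gains_independent, of "{(k, i), (k, k)}"]
    unfolding X_def[symmetric] by (rule indep_vars_compose2) (auto simp: Y_def)
  have Y: "(\<lambda>\<omega>. Y (k, i) (X (k, i) \<omega>)) = (\<lambda>\<omega>. f (L k i \<omega>))"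
    "(\<lambda>\<omega>. Y (k, k) (X (k, k) \<omega>)) = on_off_power L \<tau> k"
    using assms(1) by (auto simp: Y_def X_def on_off_power_def)
  have int: "integrable P (\<lambda>\<omega>. Y p (X p \<omega>))" if "p \<in> {(k, i), (k, k)}" for p
    using that f on_off_power_integral[OF assms(2), of k] Y by (auto simp: has_bochner_integral_iff)
  have "has_bochner_integral P (\<lambda>\<omega>. \<Prod>p\<in>{(k, i), (k, k)}. Y p (X p \<omega>))
      (\<Prod>p\<in>{(k, i), (k, k)}. \<integral>\<omega>. Y p (X p \<omega>) \<partial>P)"
    using indep_vars_lebesgue_integral[OF _ ind int] indep_vars_integrable[OF _ ind int]
    by (simp add: has_bochner_integral_iff)
  then show ?thesis
    using assms(1) f on_off_power_integral[OF assms(2), of k]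
    by (simp add: Y fun_cong[OF Y(1)] fun_cong[OF Y(2)] has_bochner_integral_iff)
qed

lemma interferer_nonneg: "AE \<omega> in P. 0 \<le> L k i \<omega> * on_off_power L \<tau> k \<omega>"
  using gain_nonneg[of k i] by eventually_elim (simp add: on_off_power_def)

lemma interferer_mean:
  assumes "k \<noteq> i" "0 \<le> \<tau>"
  shows "has_bochner_integral P (\<lambda>\<omega>. L k i \<omega> * on_off_power L \<tau> k \<omega>) (\<alpha> * \<mu> * exp (- \<tau>))"
  using gain_power_product[OF assms, of "\<lambda>x. x"] cross_gain_mean[OF assms(1)] by simp

lemma interferer_square:
  assumes "k \<noteq> i" "0 \<le> \<tau>"
  shows "integrable P (\<lambda>\<omega>. (L k i \<omega> * on_off_power L \<tau> k \<omega>)\<^sup>2)"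
    and "expectation (\<lambda>\<omega>. (L k i \<omega> * on_off_power L \<tau> k \<omega>)\<^sup>2) \<le> 2 * \<alpha> * \<beta>max\<^sup>2 * exp (- \<tau>)"
proof -
  have sq: "(L k i \<omega> * on_off_power L \<tau> k \<omega>)\<^sup>2 = (L k i \<omega>)\<^sup>2 * on_off_power L \<tau> k \<omega>" for \<omega>
    by (simp add: on_off_power_def)
  have *: "has_bochner_integral P (\<lambda>\<omega>. (L k i \<omega> * on_off_power L \<tau> k \<omega>)\<^sup>2)
      (expectation (\<lambda>\<omega>. (L k i \<omega>)\<^sup>2) * exp (- \<tau>))"
    unfolding sq
    by (rule gain_power_product[OF assms, of "\<lambda>x. x\<^sup>2"])
      (simp_all add: has_bochner_integral_iff cross_gain_square(1)[OF assms(1)])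
  then show "integrable P (\<lambda>\<omega>. (L k i \<omega> * on_off_power L \<tau> k \<omega>)\<^sup>2)"
    by (simp add: has_bochner_integral_iff)
  show "expectation (\<lambda>\<omega>. (L k i \<omega> * on_off_power L \<tau> k \<omega>)\<^sup>2) \<le> 2 * \<alpha> * \<beta>max\<^sup>2 * exp (- \<tau>)"
    using * cross_gain_square(2)[OF assms(1)] by (simp add: has_bochner_integral_iff)
qed

lemma interferer_laplace:
  assumes "k \<noteq> i" "0 \<le> \<tau>" "0 \<le> z"
  shows "integrable P (\<lambda>\<omega>. exp (- z * (L k i \<omega> * on_off_power L \<tau> k \<omega>)))"
    and "expectation (\<lambda>\<omega>. exp (- z * (L k i \<omega> * on_off_power L \<tau> k \<omega>)))
      \<le> 1 - \<alpha> * exp (- \<tau>) * (z * \<beta>min / (1 + z * \<beta>min))"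
proof -
  let ?E = "expectation (\<lambda>\<omega>. exp (- z * L k i \<omega>))"
  have "has_bochner_integral P (\<lambda>\<omega>. (1 - exp (- z * L k i \<omega>)) * on_off_power L \<tau> k \<omega>)
      ((1 - ?E) * exp (- \<tau>))"
    using exp_gain_integrable[OF assms(3), of k i]
    by (intro gain_power_product[OF assms(1,2), of "\<lambda>x. 1 - exp (- z * x)"])
      (simp_all add: has_bochner_integral_iff prob_space)
  then have "has_bochner_integral P (\<lambda>\<omega>. 1 - (1 - exp (- z * L k i \<omega>)) * on_off_power L \<tau> k \<omega>)
      (1 - (1 - ?E) * exp (- \<tau>))"
    by (simp add: has_bochner_integral_iff prob_space)
  \<comment> \<open>The power is 0 or 1, so the exponential of the product is affine in it.\<close>
  also have "(\<lambda>\<omega>. 1 - (1 - exp (- z * L k i \<omega>)) * on_off_power L \<tau> k \<omega>)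
      = (\<lambda>\<omega>. exp (- z * (L k i \<omega> * on_off_power L \<tau> k \<omega>)))"
    by (intro ext) (simp add: on_off_power_def)
  finally have *: "has_bochner_integral P (\<lambda>\<omega>. exp (- z * (L k i \<omega> * on_off_power L \<tau> k \<omega>)))
      (1 - (1 - ?E) * exp (- \<tau>))" .
  then show "integrable P (\<lambda>\<omega>. exp (- z * (L k i \<omega> * on_off_power L \<tau> k \<omega>)))"
    by (simp add: has_bochner_integral_iff)
  have "\<alpha> * (z * \<beta>min / (1 + z * \<beta>min)) * exp (- \<tau>) \<le> (1 - ?E) * exp (- \<tau>)"
    using cross_gain_laplace[OF assms(1,3)] by (intro mult_right_mono) auto
  then show "expectation (\<lambda>\<omega>. exp (- z * (L k i \<omega> * on_off_power L \<tau> k \<omega>)))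
      \<le> 1 - \<alpha> * exp (- \<tau>) * (z * \<beta>min / (1 + z * \<beta>min))"
    using has_bochner_integral_integral_eq[OF *] by (simp add: mult_ac)
qed

text \<open>Interferer \<open>k\<close> depends only on the block \<open>{(k, i), (k, k)}\<close> of
  the array. Blocks for different \<open>k\<close> are disjoint, and for \<open>k = i\<close> the
  block is the direct link alone, so signal and interferers are jointly independent.\<close>

lemma receiver_indep:
  "indep_vars (\<lambda>_. borel)
    (\<lambda>k. if k = i then h i i else (\<lambda>\<omega>. L k i \<omega> * on_off_power L \<tau> k \<omega>)) C"
proof -
  define X where "X = (\<lambda>(k, i). L k i)"
  define B where "B k = {(k, i), (k, k)}" for k
  define Y where "Y k f = (if k = i then f (i, i) else f (k, i) * (if f (k, k) > \<tau> then 1 else 0))"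
    for k and f :: "nat \<times> nat \<Rightarrow> real"
  have "indep_vars (\<lambda>k. PiM (B k) (\<lambda>_. borel)) (\<lambda>k \<omega>. restrict (\<lambda>p. X p \<omega>) (B k)) C"
    using gains_independent unfolding X_def[symmetric]
    by (rule indep_vars_restrict) (auto simp: disjoint_family_on_def B_def)
  then have "indep_vars (\<lambda>_. borel) (\<lambda>k \<omega>. Y k (restrict (\<lambda>p. X p \<omega>) (B k))) C"
  proof (rule indep_vars_compose2)
    fix k
    have m [measurable]: "(\<lambda>f. f (k, i)) \<in> borel_measurable (PiM (B k) (\<lambda>_. borel :: real measure))"
      "(\<lambda>f. f (k, k)) \<in> borel_measurable (PiM (B k) (\<lambda>_. borel :: real measure))"
      by (auto intro!: measurable_component_singleton simp: B_def)
    show "Y k \<in> borel_measurable (PiM (B k) (\<lambda>_. borel))"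
      by (cases "k = i") (use m in \<open>simp_all add: Y_def[abs_def]\<close>)
  qed
  also have "(\<lambda>k \<omega>. Y k (restrict (\<lambda>p. X p \<omega>) (B k)))
      = (\<lambda>k. if k = i then h i i else (\<lambda>\<omega>. L k i \<omega> * on_off_power L \<tau> k \<omega>))"
    by (intro ext) (auto simp: Y_def B_def X_def on_off_power_def gain_self)
  finally show ?thesis .
qed

lemma interferers_indep:
  "indep_vars (\<lambda>_. borel) (\<lambda>k \<omega>. L k i \<omega> * on_off_power L \<tau> k \<omega>) (C - {i})"
  by (rule indep_vars_cong[THEN iffD1, OF _ _ _ indep_vars_subset[OF receiver_indep]])
    auto

lemma receiver_signal:
  assumes "finite C" "i \<in> C" "0 \<le> \<tau>"
  shows "exponential_signal P (h i i) (interference L \<tau> C i)"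
proof
  show "distributed P lborel (h i i) (exponential_density 1)"
    by (rule h_exponential)
  have "insert i (C - {i}) = C"
    using assms by auto
  then have "indep_var borel ((\<lambda>k. if k = i then h i i else (\<lambda>\<omega>. L k i \<omega> * on_off_power L \<tau> k \<omega>)) i)
      borel (\<lambda>\<omega>. \<Sum>k\<in>C - {i}. (if k = i then h i i else (\<lambda>\<omega>. L k i \<omega> * on_off_power L \<tau> k \<omega>)) \<omega>)"
    using receiver_indep[of i \<tau> C] assms by (intro indep_vars_sum) auto
  also have "(\<lambda>\<omega>. \<Sum>k\<in>C - {i}. (if k = i then h i i else (\<lambda>\<omega>. L k i \<omega> * on_off_power L \<tau> k \<omega>)) \<omega>)
      = interference L \<tau> C i"
    by (intro ext) (auto simp: interference_def intro!: sum.cong)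
  finally show "indep_var borel (h i i) borel (interference L \<tau> C i)"
    by simp
  have "AE \<omega> in P. \<forall>k\<in>C - {i}. 0 \<le> L k i \<omega> * on_off_power L \<tau> k \<omega>"
    using assms interferer_nonneg by (intro AE_finite_allI) auto
  then show "AE \<omega> in P. 0 \<le> interference L \<tau> C i \<omega>"
    by eventually_elim (auto simp: interference_def intro!: sum_nonneg)
  show "integrable P (interference L \<tau> C i)"
    unfolding interference_def[abs_def]
    using interferer_mean[OF _ assms(3)] by (intro Bochner_Integration.integrable_sum) (auto simp: has_bochner_integral_iff)
qed

lemma interference_mean:
  assumes "finite C" "i \<in> C" "0 \<le> \<tau>"
  shows "expectation (interference L \<tau> C i) = real (card C - 1) * (\<alpha> * \<mu> * exp (- \<tau>))"
proof -
  have "has_bochner_integral P (interference L \<tau> C i) (\<Sum>k\<in>C - {i}. \<alpha> * \<mu> * exp (- \<tau>))"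
    unfolding interference_def[abs_def]
    using interferer_mean[OF _ assms(3)] by (intro has_bochner_integral_sum) auto
  then show ?thesis
    using assms by (simp add: has_bochner_integral_iff)
qed

lemma interference_variance:
  assumes "finite C" "i \<in> C" "0 \<le> \<tau>"
  shows "integrable P (\<lambda>\<omega>. (expectation (interference L \<tau> C i) - interference L \<tau> C i \<omega>)\<^sup>2)" (is ?int)
    and "expectation (\<lambda>\<omega>. (expectation (interference L \<tau> C i) - interference L \<tau> C i \<omega>)\<^sup>2)
      \<le> real (card C - 1) * (2 * \<alpha> * \<beta>max\<^sup>2 * exp (- \<tau>))" (is ?le)
proof -
  let ?X = "\<lambda>k \<omega>. L k i \<omega> * on_off_power L \<tau> k \<omega>"
  have int: "integrable P (?X k)" if "k \<in> C - {i}" for k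
    using interferer_mean[OF _ assms(3), of k i] that by (auto simp: has_bochner_integral_iff)
  have e: "(\<Sum>k\<in>C - {i}. expectation (?X k)) = expectation (interference L \<tau> C i)"
    unfolding interference_def[abs_def] using int by (intro Bochner_Integration.integral_sum[symmetric])
  have *: "?int \<and> expectation (\<lambda>\<omega>. (expectation (interference L \<tau> C i) - interference L \<tau> C i \<omega>)\<^sup>2)
      \<le> (\<Sum>k\<in>C - {i}. expectation (\<lambda>\<omega>. (?X k \<omega>)\<^sup>2))"
    using expectation_square_sum_centered_le[OF _ interferers_indep[of i \<tau> C] int
        interferer_square(1)[OF _ assms(3)]] assms
    unfolding e by (simp add: interference_def)
  have "(\<Sum>k\<in>C - {i}. expectation (\<lambda>\<omega>. (?X k \<omega>)\<^sup>2)) \<le> (\<Sum>k\<in>C - {i}. 2 * \<alpha> * \<beta>max\<^sup>2 * exp (- \<tau>))"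
    using interferer_square(2)[OF _ assms(3)] by (intro sum_mono) auto
  then show ?le
    using * assms by simp
  show ?int
    using * by simp
qed

text \<open>Chernoff's bound, where independence turns the Laplace transform of the sum into a
  product over the interferers.\<close>

lemma interference_prob_less:
  assumes "finite C" "i \<in> C" "0 \<le> \<tau>" "0 \<le> z"
  shows "prob {\<omega> \<in> space P. interference L \<tau> C i \<omega> < x}
    \<le> exp (z * x) * (1 - \<alpha> * exp (- \<tau>) * (z * \<beta>min / (1 + z * \<beta>min))) ^ (card C - 1)"
proof -
  let ?X = "\<lambda>k \<omega>. L k i \<omega> * on_off_power L \<tau> k \<omega>"
  let ?r = "1 - \<alpha> * exp (- \<tau>) * (z * \<beta>min / (1 + z * \<beta>min))"
  interpret exponential_signal P "h i i" "interference L \<tau> C i"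
    by (rule receiver_signal[OF assms(1-3)])
  have ind: "indep_vars (\<lambda>_. borel) (\<lambda>k \<omega>. exp (- z * ?X k \<omega>)) (C - {i})"
    by (rule indep_vars_compose2[OF interferers_indep[of i \<tau> C], of "\<lambda>_ x. exp (- z * x)"]) simp
  have int: "integrable P (\<lambda>\<omega>. exp (- z * ?X k \<omega>))" if "k \<in> C - {i}" for k
    using interferer_laplace(1)[OF _ assms(3,4)] that by auto
  have e: "exp (- z * interference L \<tau> C i \<omega>) = (\<Prod>k\<in>C - {i}. exp (- z * ?X k \<omega>))" for \<omega>
    using assms(1) by (simp add: interference_def sum_distrib_left exp_sum)
  have fin: "finite (C - {i})"
    using assms(1) by simp
  have "prob {\<omega> \<in> space P. interference L \<tau> C i \<omega> < x}
      \<le> exp (z * x) * expectation (\<lambda>\<omega>. exp (- z * interference L \<tau> C i \<omega>))"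
    using indep_vars_integrable[OF fin ind int]
    by (intro prob_less_le_exp_moment I_measurable assms(4)) (simp only: e)
  also have "expectation (\<lambda>\<omega>. exp (- z * interference L \<tau> C i \<omega>))
      = (\<Prod>k\<in>C - {i}. expectation (\<lambda>\<omega>. exp (- z * ?X k \<omega>)))"
    unfolding e by (rule indep_vars_lebesgue_integral[OF fin ind int])
  also have "\<dots> \<le> (\<Prod>k\<in>C - {i}. ?r)"
    using interferer_laplace(2)[OF _ assms(3,4)] by (intro prod_mono) auto
  finally show ?thesis
    using assms(1,2) by simp
qed

end

subsection \<open>Bounds on the average sum-rate\<close>

context random_network begin

lemma rate_eq:
  "rate L W N0 M \<tau> C i \<omega> = W / real M *
    (of_bool (\<tau> < h i i \<omega>) * ln (1 + h i i \<omega> / (interference L \<tau> C i \<omega> + N0 * W / real M)))"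
  by (simp add: rate_def on_off_power_def gain_self)

lemma rate_expectation_integrable:
  assumes "0 \<le> \<tau>" "0 < W" "0 < N0" "0 < M" "finite C" "i \<in> C"
  shows "integrable P (rate L W N0 M \<tau> C i)"
proof -
  interpret exponential_signal P "h i i" "interference L \<tau> C i"
    by (rule receiver_signal[OF assms(5,6,1)])
  have "integrable P (\<lambda>\<omega>. of_bool (\<tau> < h i i \<omega>) *
      ln (1 + h i i \<omega> / (interference L \<tau> C i \<omega> + N0 * W / real M)))"
    using assms by (intro rate_integrable) auto
  then show ?thesis
    by (simp add: rate_eq[abs_def])
qed

lemma finite_cluster: "finite (cluster K M j)"
  by (simp add: cluster_def)

lemma card_cluster: "1 \<le> j \<Longrightarrow> card (cluster K M j) = K div M"
  by (cases j) (simp_all add: cluster_def)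

lemma average_sum_rate_eq:
  assumes "0 \<le> \<tau>" "0 < W" "0 < N0" "0 < M"
  shows "average_sum_rate P L W N0 K M \<tau>
    = (\<Sum>j=1..M. \<Sum>l\<in>cluster K M j. expectation (rate L W N0 M \<tau> (cluster K M j) l))"
proof -
  have int: "integrable P (rate L W N0 M \<tau> (cluster K M j) l)" if "l \<in> cluster K M j" for j l
    by (rule rate_expectation_integrable[OF assms finite_cluster that])
  then show ?thesis
    unfolding average_sum_rate_def
    by (subst Bochner_Integration.integral_sum)
      (auto intro!: Bochner_Integration.integrable_sum sum.cong Bochner_Integration.integral_sum)
qed

text \<open>Direct gains are almost surely positive, so every negative threshold activates all users
  just as threshold 0 does. This reduces suprema over real thresholds to the range of the
  estimates.\<close>

lemma average_sum_rate_max_0: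
  "average_sum_rate P L W N0 K M \<tau> = average_sum_rate P L W N0 K M (max 0 \<tau>)"
proof (cases "0 \<le> \<tau>")
  case False
  have m [measurable]: "rate L W N0 M \<tau> C l \<in> borel_measurable P" for \<tau> C l
    unfolding rate_def[abs_def] interference_def by measurable
  \<comment> \<open>A finite index set containing all clusters, so that positivity holds
    simultaneously.\<close>
  have "AE \<omega> in P. \<forall>k\<in>{..K * Suc M}. 0 < h k k \<omega>"
    using exponential_AE_pos[OF h_exponential] by (intro AE_finite_allI) auto
  then have "AE \<omega> in P. (\<Sum>j=1..M. \<Sum>l\<in>cluster K M j. rate L W N0 M \<tau> (cluster K M j) l \<omega>)
      = (\<Sum>j=1..M. \<Sum>l\<in>cluster K M j. rate L W N0 M 0 (cluster K M j) l \<omega>)"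
  proof eventually_elim
    case (elim \<omega>)
    have sub: "cluster K M j \<subseteq> {..K * Suc M}" if "j \<in> {1..M}" for j
    proof -
      have "j * (K div M) \<le> M * K"
        using that by (intro mult_mono) auto
      then show ?thesis
        by (auto simp: cluster_def algebra_simps)
    qed
    have eq: "on_off_power L \<tau> k \<omega> = on_off_power L 0 k \<omega>" if "k \<in> {..K * Suc M}" for k
      using bspec[OF elim that] False by (auto simp: on_off_power_def gain_self)
    have "rate L W N0 M \<tau> (cluster K M j) l \<omega> = rate L W N0 M 0 (cluster K M j) l \<omega>"
      if "j \<in> {1..M}" "l \<in> cluster K M j" for j l
    proof -
      have "interference L \<tau> (cluster K M j) l \<omega> = interference L 0 (cluster K M j) l \<omega>"
        unfolding interference_def
      proof (rule sum.cong)
        fix k assume "k \<in> cluster K M j - {l}"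
        then have "k \<in> {..K * Suc M}"
          using sub[OF that(1)] by blast
        then show "L k l \<omega> * on_off_power L \<tau> k \<omega> = L k l \<omega> * on_off_power L 0 k \<omega>"
          by (simp only: eq)
      qed simp
      moreover have "on_off_power L \<tau> l \<omega> = on_off_power L 0 l \<omega>"
        using sub[OF that(1)] that(2) by (intro eq) blast
      ultimately show ?thesis
        by (simp only: rate_def)
    qed
    then show ?case
      by (intro sum.cong) auto
  qed
  then show ?thesis
    using False unfolding average_sum_rate_def by (auto intro!: integral_cong_AE)
qed simp

text \<open>\<open>M\<close> clusters of \<open>K div M\<close> users with prefactor
  \<open>W / M\<close> each; the bound \<open>r\<close> may depend on a cluster only through its
  size.\<close>

lemma average_sum_rate_le:
  assumes "0 \<le> \<tau>" "0 < W" "0 < N0" "0 < M"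
    and le: "\<And>C i. finite C \<Longrightarrow> i \<in> C \<Longrightarrow> card C = K div M \<Longrightarrow>
      expectation (\<lambda>\<omega>. of_bool (\<tau> < h i i \<omega>) *
        ln (1 + h i i \<omega> / (interference L \<tau> C i \<omega> + N0 * W / real M))) \<le> r"
  shows "average_sum_rate P L W N0 K M \<tau> \<le> W * (real (K div M) * r)"
proof -
  have "average_sum_rate P L W N0 K M \<tau> \<le> (\<Sum>j=1..M. \<Sum>l\<in>cluster K M j. W / real M * r)"
    unfolding average_sum_rate_eq[OF assms(1-4)]
    using assms(2,4) le[OF finite_cluster]
    by (intro sum_mono) (auto simp: rate_eq[abs_def] card_cluster intro!: mult_left_mono divide_right_mono)
  also have "\<dots> = (\<Sum>j=1..M. real (K div M) * (W / real M * r))"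
    by (intro sum.cong) (auto simp: card_cluster)
  also have "\<dots> = W * (real (K div M) * r)"
    using assms(4) by simp
  finally show ?thesis .
qed

lemma average_sum_rate_ge:
  assumes "0 \<le> \<tau>" "0 < W" "0 < N0" "0 < M"
    and ge: "\<And>C i. finite C \<Longrightarrow> i \<in> C \<Longrightarrow> card C = K div M \<Longrightarrow>
      r \<le> expectation (\<lambda>\<omega>. of_bool (\<tau> < h i i \<omega>) *
        ln (1 + h i i \<omega> / (interference L \<tau> C i \<omega> + N0 * W / real M)))"
  shows "W * (real (K div M) * r) \<le> average_sum_rate P L W N0 K M \<tau>"
proof -
  have "W * (real (K div M) * r) = (\<Sum>j=1..M. real (K div M) * (W / real M * r))"
    using assms(4) by simp
  also have "\<dots> = (\<Sum>j=1..M. \<Sum>l\<in>cluster K M j. W / real M * r)"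
    by (intro sum.cong) (auto simp: card_cluster)
  also have "\<dots> \<le> average_sum_rate P L W N0 K M \<tau>"
    unfolding average_sum_rate_eq[OF assms(1-4)]
    using assms(2,4) ge[OF finite_cluster]
    by (intro sum_mono) (auto simp: rate_eq[abs_def] card_cluster intro!: mult_left_mono divide_right_mono)
  finally show ?thesis .
qed

lemma average_sum_rate_le_concentrated:
  assumes "0 \<le> \<tau>" "0 < W" "0 < N0" "0 < M" "0 < \<alpha>" "2 \<le> K div M"
  defines "n \<equiv> real (K div M)" and "q \<equiv> exp (- \<tau>)"
  defines "m \<equiv> (n - 1) * (\<alpha> * \<mu> * q)"
  shows "average_sum_rate P L W N0 K M \<tau> \<le> W * (n * (q * (ln (1 + (\<tau> + 1) / m)
      + 4 * \<beta>max\<^sup>2 / \<beta>min * (\<tau> + 1) / m\<^sup>2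
      + exp (- \<alpha> / 12 * ((n - 1) * q)) * ln (1 + (\<tau> + 1) / (N0 * W / real M)))))"
  unfolding n_def
proof (rule average_sum_rate_le[OF assms(1-4)])
  fix C :: "nat set" and i
  assume C: "finite C" "i \<in> C" "card C = K div M"
  interpret exponential_signal P "h i i" "interference L \<tau> C i"
    by (rule receiver_signal[OF C(1,2) assms(1)])
  let ?I = "interference L \<tau> C i"
  have n1: "1 \<le> n - 1" "real (card C - 1) = n - 1"
    using assms(6) C by (auto simp: n_def)
  have pos: "0 < \<beta>min" "0 < \<mu>" "0 < q" "\<beta>min \<le> \<mu>"
    using beta_min_pos beta_range by (auto simp: q_def)
  have m: "expectation ?I = m"
    unfolding interference_mean[OF C(1,2) assms(1)] n1(2) by (simp only: m_def q_def)
  have m0: "0 < m"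
    unfolding m_def using n1(1) pos assms(5) by (intro mult_pos_pos) auto
  define v where "v = (n - 1) * (2 * \<alpha> * \<beta>max\<^sup>2 * q)"
  \<comment> \<open>Chosen together with \<open>z = 1 / (2 * \<beta>min)\<close> for the tail bound:
    the Chernoff factor is \<open>exp (\<alpha> / 4 * ((n - 1) * q))\<close>, the Laplace product at
    most \<open>exp (- \<alpha> / 3 * ((n - 1) * q))\<close>, and the exponent
    \<open>- \<alpha> / 12\<close> per expected active interferer remains.\<close>
  define \<theta> where "\<theta> = \<beta>min / (2 * \<mu>)"
  have \<theta>: "0 < \<theta>" "\<theta> \<le> 1"
    using pos by (auto simp: \<theta>_def)
  have v: "(\<tau> + 1) * v / (\<theta> * m ^ 3) = 4 * \<beta>max\<^sup>2 / \<beta>min * (\<tau> + 1) / m\<^sup>2"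
  proof -
    \<comment> \<open>The variance bound is proportional to the mean, so one power of
      \<open>m\<close> cancels.\<close>
    have "v = 2 * \<beta>max\<^sup>2 / \<mu> * m"
      using pos by (simp add: v_def m_def)
    then show ?thesis
      using pos(1,2) m0 by (simp add: \<theta>_def power2_eq_square power3_eq_cube)
  qed
  have nq: "0 \<le> \<alpha> * q" "\<alpha> * q \<le> 1"
    using alpha_range assms(1) by (auto simp: q_def intro!: mult_le_one)
  have "prob {\<omega> \<in> space P. ?I \<omega> < \<theta> * m} \<le> exp (1 / (2 * \<beta>min) * (\<theta> * m)) *
      (1 - \<alpha> * exp (- \<tau>) * (1 / (2 * \<beta>min) * \<beta>min / (1 + 1 / (2 * \<beta>min) * \<beta>min))) ^ (card C - 1)"
    using pos by (intro interference_prob_less[OF C(1,2) assms(1)]) auto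
  also have "1 / (2 * \<beta>min) * \<beta>min / (1 + 1 / (2 * \<beta>min) * \<beta>min) = 1 / 3"
    using pos by simp
  also have "1 / (2 * \<beta>min) * (\<theta> * m) = \<alpha> / 4 * ((n - 1) * q)"
    using pos by (simp add: \<theta>_def m_def)
  also have "(1 - \<alpha> * exp (- \<tau>) * (1 / 3)) ^ (card C - 1) \<le> exp (- (\<alpha> * q / 3)) ^ (card C - 1)"
    using nq exp_ge_add_one_self[of "- (\<alpha> * q / 3)"]
    by (intro power_mono) (auto simp: q_def)
  also have "exp (- (\<alpha> * q / 3)) ^ (card C - 1) = exp (- \<alpha> / 3 * ((n - 1) * q))"
    unfolding exp_of_nat_mult[symmetric] n1(2) by (simp add: algebra_simps)
  also have "exp (\<alpha> / 4 * ((n - 1) * q)) * exp (- \<alpha> / 3 * ((n - 1) * q)) = exp (- \<alpha> / 12 * ((n - 1) * q))"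
    by (simp add: exp_add[symmetric])
  finally have p: "prob {\<omega> \<in> space P. ?I \<omega> < \<theta> * m} \<le> exp (- \<alpha> / 12 * ((n - 1) * q))"
    by simp
  have "expectation (\<lambda>\<omega>. of_bool (\<tau> < h i i \<omega>) * ln (1 + h i i \<omega> / (?I \<omega> + N0 * W / real M)))
    \<le> exp (- \<tau>) * (ln (1 + (\<tau> + 1) / m) + (\<tau> + 1) * v / (\<theta> * m ^ 3)
        + prob {\<omega> \<in> space P. ?I \<omega> < \<theta> * m} * ln (1 + (\<tau> + 1) / (N0 * W / real M)))"
    using interference_variance[OF C(1,2) assms(1), unfolded n1(2) m] assms(1-4) m m0 \<theta>
    by (intro rate_expectation_le_concentrated) (auto simp: v_def q_def)
  also have "\<dots> \<le> exp (- \<tau>) * (ln (1 + (\<tau> + 1) / m) + (\<tau> + 1) * v / (\<theta> * m ^ 3)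
        + exp (- \<alpha> / 12 * ((n - 1) * q)) * ln (1 + (\<tau> + 1) / (N0 * W / real M)))"
    using assms(1-4) by (intro mult_left_mono add_left_mono mult_right_mono p ln_ge_zero) auto
  finally show "expectation (\<lambda>\<omega>. of_bool (\<tau> < h i i \<omega>) * ln (1 + h i i \<omega> / (?I \<omega> + N0 * W / real M)))
    \<le> q * (ln (1 + (\<tau> + 1) / m) + 4 * \<beta>max\<^sup>2 / \<beta>min * (\<tau> + 1) / m\<^sup>2
      + exp (- \<alpha> / 12 * ((real (K div M) - 1) * q)) * ln (1 + (\<tau> + 1) / (N0 * W / real M)))"
    unfolding v q_def n_def .
qed

lemma average_sum_rate_le_split:
  assumes "0 \<le> \<tau>" "0 < W" "0 < N0" "0 < M" "0 \<le> z" "0 < \<eta>"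
  shows "average_sum_rate P L W N0 K M \<tau> \<le> W * (real (K div M) * (exp (- \<tau>) *
      (exp (z * \<eta>) * (1 - \<alpha> * exp (- \<tau>) * (z * \<beta>min / (1 + z * \<beta>min))) ^ (K div M - 1)
        * ln (1 + (\<tau> + 1) / (N0 * W / real M)) + ln (1 + (\<tau> + 1) / \<eta>))))"
proof (rule average_sum_rate_le[OF assms(1-4)])
  fix C :: "nat set" and i
  assume C: "finite C" "i \<in> C" "card C = K div M"
  interpret exponential_signal P "h i i" "interference L \<tau> C i"
    by (rule receiver_signal[OF C(1,2) assms(1)])
  have "expectation (\<lambda>\<omega>. of_bool (\<tau> < h i i \<omega>) *
      ln (1 + h i i \<omega> / (interference L \<tau> C i \<omega> + N0 * W / real M)))
    \<le> exp (- \<tau>) * (prob {\<omega> \<in> space P. interference L \<tau> C i \<omega> < \<eta>} *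
      ln (1 + (\<tau> + 1) / (N0 * W / real M)) + ln (1 + (\<tau> + 1) / \<eta>))"
    using assms by (intro rate_expectation_le_split) auto
  also have "\<dots> \<le> exp (- \<tau>) *
      (exp (z * \<eta>) * (1 - \<alpha> * exp (- \<tau>) * (z * \<beta>min / (1 + z * \<beta>min))) ^ (card C - 1)
        * ln (1 + (\<tau> + 1) / (N0 * W / real M)) + ln (1 + (\<tau> + 1) / \<eta>))"
    using assms(1-4)
    by (intro mult_left_mono add_right_mono mult_right_mono interference_prob_less C(1,2) assms(5) ln_ge_zero) auto
  finally show "expectation (\<lambda>\<omega>. of_bool (\<tau> < h i i \<omega>) *
      ln (1 + h i i \<omega> / (interference L \<tau> C i \<omega> + N0 * W / real M))) \<le> exp (- \<tau>) *
      (exp (z * \<eta>) * (1 - \<alpha> * exp (- \<tau>) * (z * \<beta>min / (1 + z * \<beta>min))) ^ (K div M - 1)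
        * ln (1 + (\<tau> + 1) / (N0 * W / real M)) + ln (1 + (\<tau> + 1) / \<eta>))"
    unfolding C .
qed

lemma average_sum_rate_single_ge:
  assumes \<tau>: "0 \<le> \<tau>" and "0 < W" "0 < N0" and B: "2 \<le> B + (\<tau> + 1)" "real K * exp (- \<tau>) * (\<alpha> * \<mu>) + N0 * W \<le> B"
  shows "W * (real K * (exp (- \<tau>) * (ln (1 + (\<tau> + 1) / B) - 2 / (B + (\<tau> + 1))\<^sup>2)))
    \<le> average_sum_rate P L W N0 K 1 \<tau>"
proof -
  have "W * (real (K div 1) * (exp (- \<tau>) * (ln (1 + (\<tau> + 1) / B) - 2 / (B + (\<tau> + 1))\<^sup>2)))
    \<le> average_sum_rate P L W N0 K 1 \<tau>"
  proof (rule average_sum_rate_ge[OF \<tau> assms(2,3)])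
    fix C :: "nat set" and i
    assume C: "finite C" "i \<in> C" "card C = K div 1"
    interpret exponential_signal P "h i i" "interference L \<tau> C i"
      by (rule receiver_signal[OF C(1,2) \<tau>])
    have "real (card C - 1) * (\<alpha> * \<mu> * exp (- \<tau>)) \<le> real K * (\<alpha> * \<mu> * exp (- \<tau>))"
      using C alpha_range beta_range beta_min_pos by (intro mult_right_mono) auto
    then have "expectation (interference L \<tau> C i) + N0 * W / real 1 \<le> B"
      using B(2) interference_mean[OF C(1,2) \<tau>] by (simp add: mult_ac)
    then show "exp (- \<tau>) * (ln (1 + (\<tau> + 1) / B) - 2 / (B + (\<tau> + 1))\<^sup>2)
      \<le> expectation (\<lambda>\<omega>. of_bool (\<tau> < h i i \<omega>) *
        ln (1 + h i i \<omega> / (interference L \<tau> C i \<omega> + N0 * W / real 1)))"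
      using assms by (intro rate_expectation_ge) auto
  qed simp
  then show ?thesis by simp
qed

text \<open>The split bound with \<open>z = 0\<close> and \<open>\<eta> = 1\<close>, combined with
  \<open>exp (- t) * (t + 1) \<le> 1\<close> for the clipped threshold. It makes the suprema genuine
  upper bounds.\<close>

lemma average_sum_rate_bdd_above:
  assumes "0 < W" "0 < N0" "0 < M"
  shows "bdd_above (range (average_sum_rate P L W N0 K M))"
proof (rule bdd_aboveI2)
  fix \<tau> :: real
  let ?t = "max 0 \<tau>" and ?s = "N0 * W / real M"
  have s: "0 < ?s" using assms by simp
  have ln: "ln (1 + (?t + 1) / x) \<le> (?t + 1) / x" if "0 < x" for x
    using that by (intro ln_add_one_self_le_self) auto
  have e: "exp (- ?t) * (?t + 1) \<le> 1"
    using exp_ge_add_one_self[of ?t] by (simp add: exp_minus field_simps)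
  have "average_sum_rate P L W N0 K M \<tau> \<le> W * (real (K div M) * (exp (- ?t) *
      (ln (1 + (?t + 1) / ?s) + ln (1 + (?t + 1) / 1))))"
    using average_sum_rate_le_split[of ?t W N0 M 0 1 K] assms
    unfolding average_sum_rate_max_0[of W N0 K M \<tau>] by simp
  also have "\<dots> \<le> W * (real (K div M) * (exp (- ?t) * ((?t + 1) / ?s + (?t + 1) / 1)))"
    using assms ln[OF s] ln[of 1] by (intro mult_left_mono add_mono) auto
  also have "\<dots> = W * (real (K div M) * (exp (- ?t) * (?t + 1) * (1 / ?s + 1)))"
    by (simp only: mult.assoc distrib_left div_by_1 mult_1_right times_divide_eq_right)
  also have "\<dots> \<le> W * (real (K div M) * (1 * (1 / ?s + 1)))"
    using assms s e by (intro mult_left_mono mult_right_mono) auto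
  finally show "average_sum_rate P L W N0 K M \<tau> \<le> W * (real (K div M) * (1 / ?s + 1))"
    by simp
qed

end

section \<open>From individual thresholds to the maximal rates\<close>

context random_network begin

lemma max_average_sum_rate_gap:
  assumes "0 < W" "0 < N0" "0 < \<alpha>" "\<alpha> < 1"
  shows "\<exists>\<delta>>0. \<forall>\<^sub>F K in sequentially. \<forall>M. 2 \<le> M \<longrightarrow> M dvd K \<longrightarrow>
    max_average_sum_rate P L W N0 K M + \<delta> \<le> max_average_sum_rate P L W N0 K 1"
proof -
  let ?F = "average_sum_rate P L W N0"
  \<comment> \<open>Division by \<open>W\<close> leaves bounds in which the bandwidth occurs only
    through \<open>N0 * W\<close>.\<close>
  define f where "f K M \<tau> = ?F K M \<tau> / W" for K M \<tau>
  have \<mu>: "0 < \<mu>"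
    using beta_min_pos beta_range by linarith
  have "\<exists>\<delta>>0. \<forall>\<^sub>F K in sequentially. \<forall>M \<tau>. 2 \<le> M \<longrightarrow> M dvd K \<longrightarrow> 0 \<le> \<tau> \<longrightarrow>
      (\<exists>\<tau>'. f K M \<tau> + \<delta> \<le> f K 1 \<tau>')"
  proof (rule single_cluster_dominates[where d = "\<alpha> * \<mu>" and b = "N0 * W" and c = "4 * \<beta>max\<^sup>2 / \<beta>min"])
    show "\<alpha> * \<mu> \<le> \<alpha>"
      using assms mean_le_1 by (simp add: mult_left_le)
    show "f K M \<tau> \<le> real (K div M) * (exp (- \<tau>) *
        (ln (1 + (\<tau> + 1) / ((real (K div M) - 1) * exp (- \<tau>) * (\<alpha> * \<mu>)))
        + 4 * \<beta>max\<^sup>2 / \<beta>min * (\<tau> + 1) / ((real (K div M) - 1) * exp (- \<tau>) * (\<alpha> * \<mu>))\<^sup>2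
        + exp (- (\<alpha> / 12) * ((real (K div M) - 1) * exp (- \<tau>))) * ln (1 + (\<tau> + 1) / (N0 * W / real M))))"
      if "0 \<le> \<tau>" "0 < M" "2 \<le> K div M" for K M \<tau>
      using average_sum_rate_le_concentrated[of \<tau> W N0 M K] assms that
      by (simp add: f_def pos_divide_le_eq mult_ac)
    show "f K M \<tau> \<le> real (K div M) * (exp (- \<tau>) *
        (exp (z * \<eta>) * (1 - \<alpha> * exp (- \<tau>) * (z * \<beta>min / (1 + z * \<beta>min))) ^ (K div M - 1)
          * ln (1 + (\<tau> + 1) / (N0 * W / real M)) + ln (1 + (\<tau> + 1) / \<eta>)))"
      if "0 \<le> \<tau>" "0 < M" "0 \<le> z" "0 < \<eta>" for K M \<tau> z \<eta>
      using average_sum_rate_le_split[of \<tau> W N0 M z \<eta> K] assms that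
      by (simp add: f_def pos_divide_le_eq mult_ac)
    show "real K * (exp (- \<tau>) * (ln (1 + (\<tau> + 1) / B) - 2 / (B + (\<tau> + 1))\<^sup>2)) \<le> f K 1 \<tau>"
      if "0 \<le> \<tau>" "2 \<le> B + (\<tau> + 1)" "real K * exp (- \<tau>) * (\<alpha> * \<mu>) + N0 * W \<le> B" for K \<tau> B
      using average_sum_rate_single_ge[of \<tau> W N0 B K] assms that
      by (simp add: f_def pos_le_divide_eq mult_ac)
  qed (use assms \<mu> beta_min_pos in auto)
  then obtain \<delta> where \<delta>: "0 < \<delta>" and ev: "\<forall>\<^sub>F K in sequentially. \<forall>M \<tau>. 2 \<le> M \<longrightarrow> M dvd K \<longrightarrow> 0 \<le> \<tau> \<longrightarrow>
      (\<exists>\<tau>'. f K M \<tau> + \<delta> \<le> f K 1 \<tau>')"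
    by blast
  have "\<forall>\<^sub>F K in sequentially. \<forall>M. 2 \<le> M \<longrightarrow> M dvd K \<longrightarrow>
      max_average_sum_rate P L W N0 K M + W * \<delta> \<le> max_average_sum_rate P L W N0 K 1"
    using ev
  proof eventually_elim
    case (elim K)
    show ?case
    proof (intro allI impI)
      fix M assume M: "2 \<le> M" "M dvd K"
      have "?F K M \<tau> \<le> max_average_sum_rate P L W N0 K 1 - W * \<delta>" for \<tau>
      proof -
        obtain \<tau>' where "f K M (max 0 \<tau>) + \<delta> \<le> f K 1 \<tau>'"
          using elim M by (meson max.cobounded1)
        then have "W * (f K M (max 0 \<tau>) + \<delta>) \<le> W * f K 1 \<tau>'"
          using assms(1) by (intro mult_left_mono) auto
        then have "?F K M \<tau> + W * \<delta> \<le> ?F K 1 \<tau>'"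
          using assms(1) by (simp add: f_def distrib_left average_sum_rate_max_0[of W N0 K M \<tau>])
        also have "\<dots> \<le> max_average_sum_rate P L W N0 K 1"
          unfolding max_average_sum_rate_def
          by (rule cSUP_upper) (use average_sum_rate_bdd_above assms in auto)
        finally show ?thesis by simp
      qed
      then have "max_average_sum_rate P L W N0 K M \<le> max_average_sum_rate P L W N0 K 1 - W * \<delta>"
        unfolding max_average_sum_rate_def[of P L W N0 K M] by (intro cSUP_least) auto
      then show "max_average_sum_rate P L W N0 K M + W * \<delta> \<le> max_average_sum_rate P L W N0 K 1"
        by simp
    qed
  qed
  then show ?thesis
    using \<delta> assms(1) by (intro exI[of _ "W * \<delta>"]) auto
qed

end

theorem theorem3:
  fixes P :: "'a measure"
    and h \<beta> :: "nat \<Rightarrow> nat \<Rightarrow> 'a \<Rightarrow> real"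
    and \<xi> :: "nat \<Rightarrow> nat \<Rightarrow> 'a \<Rightarrow> bool"
    and \<alpha> \<beta>min \<beta>max \<mu> W N0 :: real
  assumes "random_network P \<alpha> \<beta>min \<beta>max \<mu> h \<beta> \<xi>"
    and "W > 0" and "N0 > 0"
    and "0 < \<alpha>" and "\<alpha> < 1"
  shows "(\<forall>(K :: nat \<Rightarrow> nat) (M :: nat \<Rightarrow> nat) (c :: real).
            filterlim K at_top sequentially \<and>
            (\<forall>t. 1 \<le> M t \<and> M t dvd K t) \<and>
            0 < c \<and> (\<lambda>t. real (M t) / real (K t)) \<longlonglongrightarrow> c \<longrightarrow>
            (\<forall>\<^sub>F t in sequentially.
               max_average_sum_rate P (gain h \<beta> \<xi>) W N0 (K t) (M t)
               < max_average_sum_rate P (gain h \<beta> \<xi>) W N0 (K t) 1))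
       \<and> (\<forall>\<^sub>F K in sequentially.
            is_arg_max (\<lambda>M. max_average_sum_rate P (gain h \<beta> \<xi>) W N0 K M)
              (\<lambda>M. 1 \<le> M \<and> M \<le> K \<and> M dvd K) 1)"
proof -
  interpret random_network P \<alpha> \<beta>min \<beta>max \<mu> h \<beta> \<xi>
    by (rule assms(1))
  let ?R = "max_average_sum_rate P (gain h \<beta> \<xi>) W N0"
  obtain \<delta> where "0 < \<delta>" and "\<forall>\<^sub>F K in sequentially. \<forall>M. 2 \<le> M \<longrightarrow> M dvd K \<longrightarrow> ?R K M + \<delta> \<le> ?R K 1"
    using max_average_sum_rate_gap[OF assms(2-5)] by blast
  then have less: "\<forall>\<^sub>F K in sequentially. \<forall>M. 2 \<le> M \<longrightarrow> M dvd K \<longrightarrow> ?R K M < ?R K 1"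
    by (auto elim!: eventually_mono)
  show ?thesis
  proof (intro conjI allI impI; (elim conjE)?)
    fix K M :: "nat \<Rightarrow> nat" and c :: real
    assume K: "filterlim K at_top sequentially" and M: "\<forall>t. 1 \<le> M t \<and> M t dvd K t"
      and c: "0 < c" "(\<lambda>t. real (M t) / real (K t)) \<longlonglongrightarrow> c"
    \<comment> \<open>The ratio tends to \<open>c > 0\<close> while \<open>K\<close> tends to
      infinity, so the product, which is \<open>M t\<close> for \<open>K t \<noteq> 0\<close>, tends
      to infinity and eventually reaches 2.\<close>
    have "filterlim (\<lambda>t. real (M t) / real (K t) * real (K t)) at_top sequentially"
      by (rule filterlim_tendsto_pos_mult_at_top[OF c(2,1)
            filterlim_compose[OF filterlim_real_sequentially K]])
    then have "\<forall>\<^sub>F t in sequentially. 2 \<le> real (M t) / real (K t) * real (K t)"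
      by (simp add: filterlim_at_top)
    moreover have "\<forall>\<^sub>F t in sequentially. \<forall>M. 2 \<le> M \<longrightarrow> M dvd K t \<longrightarrow> ?R (K t) M < ?R (K t) 1"
      using less K by (rule eventually_compose_filterlim)
    ultimately show "\<forall>\<^sub>F t in sequentially. ?R (K t) (M t) < ?R (K t) 1"
    proof eventually_elim
      case (elim t)
      \<comment> \<open>For \<open>K t = 0\<close> the product is 0, contradicting its lower bound
        2; otherwise the factors \<open>K t\<close> cancel.\<close>
      then have "2 \<le> M t"
        by (cases "K t = 0") auto
      then show ?case
        using elim M by auto
    qed
  next
    show "\<forall>\<^sub>F K in sequentially. is_arg_max (?R K) (\<lambda>M. 1 \<le> M \<and> M \<le> K \<and> M dvd K) 1"
      using less eventually_ge_at_top[of 1]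
    proof eventually_elim
      case (elim K)
      have "?R K M \<le> ?R K 1" if "1 \<le> M" "M dvd K" for M
        using elim that by (cases "M = 1") (auto intro: less_imp_le)
      then show ?case
        using elim(2) by (auto simp: is_arg_max_def not_less)
    qed
  qed
qed

end
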